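(* Let $p$ be a prime number and let $S^n$ be a sphere with a linear $\mathbb{Z}/p$-action whose fixed point set is $(S^n)^{\mathbb{Z}/p} = S^k$, where $0<k<n$. (1) If both $n$ and $k$ are odd, then $TC_{\mathbb{Z}/p}(S^n)=2$. (2) If $n$ is even or $k$ is even, then $TC_{\mathbb{Z}/p}(S^n)=3$.
   Context: A linear $G$-sphere is the unit sphere $S^n\subset\mathbb{R}^{n+1}$ with the action of $G$ obtained by restricting an orthogonal representation of $G$ on $\mathbb{R}^{n+1}$; its fixed point set is the intersection of $S^n$ with a linear subspace, hence (if non-empty) a standard sphere $S^k$. For a topological space $X$, $PX$ is the space of continuous paths $\gamma\colon[0,1]\to X$ with the compact-open topology, and $\pi\colon PX\to X\times X$ is $\pi(\gamma)=(\gamma(0),\gamma(1))$. If $X$ is a $G$-space, $G$ acts on $PX$ by $(g\gamma)(t)=g(\gamma(t))$ and on $X\times X$ diagonally by $g(x,y)=(gx,gy)$. Equivariant topological complexity $TC_G(X)$ is the least integer $m\ge 1$ such that $X\times X$ can be covered by $m$ open $G$-invariant sets $U_1,\dots,U_m$, each admitting a $G$-equivariant continuous map $s_i\colon U_i\to PX$ with $\pi\circ s_i$ equal to the inclusion $U_i\hookrightarrow X\times X$ ($TC_G(X)=\infty$ if no such $m$ exists). Thus the invariant is non-reduced. *)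

theory Defs
  imports "HOL-Analysis.Analysis" "HOL-Algebra.Group_Action" "HOL-Algebra.Elementary_Groups"
begin

section \<open>Spaces of maps with the compact-open topology\<close>

text \<open>Maps are normalised to be \<open>undefined\<close> outside \<open>topspace X\<close>, so that equality
  of functions is equality of maps with domain \<open>X\<close>.\<close>

definition map_space :: "'a topology \<Rightarrow> 'b topology \<Rightarrow> ('a \<Rightarrow> 'b) set" where
  "map_space X Y = {f \<in> extensional (topspace X). continuous_map X Y f}"

definition compact_open_topology :: "'a topology \<Rightarrow> 'b topology \<Rightarrow> ('a \<Rightarrow> 'b) topology" where
  "compact_open_topology X Y =
     topology_generated_by
       {{f \<in> map_space X Y. f ` K \<subseteq> V} | K V. compactin X K \<and> openin Y V}"

lemma topspace_compact_open_topology [simp]: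
  "topspace (compact_open_topology X Y) = map_space X Y"
proof -
  have "map_space X Y = {f \<in> map_space X Y. f ` {} \<subseteq> topspace Y}"
    by auto
  then have "map_space X Y \<in> {{f \<in> map_space X Y. f ` K \<subseteq> V} | K V. compactin X K \<and> openin Y V}"
    using compactin_empty openin_topspace by blast
  then show ?thesis
    unfolding compact_open_topology_def topology_generated_by_topspace by blast
qed

definition path_space :: "'a topology \<Rightarrow> (real \<Rightarrow> 'a) topology" where
  "path_space X = compact_open_topology (top_of_set {0..1}) X"

definition path_ends :: "(real \<Rightarrow> 'a) \<Rightarrow> 'a \<times> 'a" where
  "path_ends \<gamma> = (\<gamma> 0, \<gamma> 1)"


section \<open>Equivariant topological complexity\<close>

definition path_action :: "('g \<Rightarrow> 'a \<Rightarrow> 'a) \<Rightarrow> 'g \<Rightarrow> (real \<Rightarrow> 'a) \<Rightarrow> (real \<Rightarrow> 'a)" where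
  "path_action \<phi> g \<gamma> = (\<lambda>t\<in>{0..1}. \<phi> g (\<gamma> t))"

definition diagonal_action :: "('g \<Rightarrow> 'a \<Rightarrow> 'a) \<Rightarrow> 'g \<Rightarrow> 'a \<times> 'a \<Rightarrow> 'a \<times> 'a" where
  "diagonal_action \<phi> g z = (\<phi> g (fst z), \<phi> g (snd z))"

definition invariant_set :: "('g, 'c) monoid_scheme \<Rightarrow> ('g \<Rightarrow> 'b \<Rightarrow> 'b) \<Rightarrow> 'b set \<Rightarrow> bool" where
  "invariant_set G \<psi> U \<longleftrightarrow> (\<forall>g\<in>carrier G. \<forall>z\<in>U. \<psi> g z \<in> U)"

definition equivariant_on ::
  "('g, 'c) monoid_scheme \<Rightarrow> ('g \<Rightarrow> 'a \<Rightarrow> 'a) \<Rightarrow> ('g \<Rightarrow> 'b \<Rightarrow> 'b) \<Rightarrow> 'a set \<Rightarrow> ('a \<Rightarrow> 'b) \<Rightarrow> bool" where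
  "equivariant_on G \<phi> \<psi> U s \<longleftrightarrow> (\<forall>g\<in>carrier G. \<forall>z\<in>U. s (\<phi> g z) = \<psi> g (s z))"

definition equivariant_motion_planner ::
  "('g, 'c) monoid_scheme \<Rightarrow> 'a topology \<Rightarrow> ('g \<Rightarrow> 'a \<Rightarrow> 'a) \<Rightarrow> ('a \<times> 'a) set
     \<Rightarrow> ('a \<times> 'a \<Rightarrow> real \<Rightarrow> 'a) \<Rightarrow> bool" where
  "equivariant_motion_planner G X \<phi> U s \<longleftrightarrow>
     continuous_map (subtopology (prod_topology X X) U) (path_space X) s \<and>
     equivariant_on G (diagonal_action \<phi>) (path_action \<phi>) U s \<and>
     (\<forall>z\<in>U. path_ends (s z) = z)"

definition has_equivariant_planner_cover ::
  "('g, 'c) monoid_scheme \<Rightarrow> 'a topology \<Rightarrow> ('g \<Rightarrow> 'a \<Rightarrow> 'a) \<Rightarrow> nat \<Rightarrow> bool" where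
  "has_equivariant_planner_cover G X \<phi> m \<longleftrightarrow>
     (\<exists>U :: nat \<Rightarrow> ('a \<times> 'a) set.
        (\<Union>i\<in>{1..m}. U i) = topspace (prod_topology X X) \<and>
        (\<forall>i\<in>{1..m}.
           openin (prod_topology X X) (U i) \<and>
           invariant_set G (diagonal_action \<phi>) (U i) \<and>
           (\<exists>s. equivariant_motion_planner G X \<phi> (U i) s)))"

text \<open>The non-reduced invariant; the infimum of the empty set is \<open>\<infinity>\<close>.\<close>

definition equivariant_TC ::
  "('g, 'c) monoid_scheme \<Rightarrow> 'a topology \<Rightarrow> ('g \<Rightarrow> 'a \<Rightarrow> 'a) \<Rightarrow> enat" where
  "equivariant_TC G X \<phi> = Inf {enat m | m. m \<ge> 1 \<and> has_equivariant_planner_cover G X \<phi> m}"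


section \<open>Linear spheres\<close>

definition orthogonal_representation ::
  "('g, 'c) monoid_scheme \<Rightarrow> ('g \<Rightarrow> 'v::euclidean_space \<Rightarrow> 'v) \<Rightarrow> bool" where
  "orthogonal_representation G \<rho> \<longleftrightarrow>
     group_action G UNIV \<rho> \<and> (\<forall>g\<in>carrier G. orthogonal_transformation (\<rho> g))"

definition sphere_action :: "('g \<Rightarrow> 'v::euclidean_space \<Rightarrow> 'v) \<Rightarrow> 'g \<Rightarrow> 'v \<Rightarrow> 'v" where
  "sphere_action \<rho> g = (\<lambda>x\<in>sphere 0 1. \<rho> g x)"

definition fixed_point_set ::
  "('g, 'c) monoid_scheme \<Rightarrow> 'b set \<Rightarrow> ('g \<Rightarrow> 'b \<Rightarrow> 'b) \<Rightarrow> 'b set" where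
  "fixed_point_set G E \<phi> = {x \<in> E. \<forall>g\<in>carrier G. \<phi> g x = x}"

text \<open>A standard \<open>k\<close>-sphere inside the unit sphere is the unit sphere of a
  \<open>(k+1)\<close>-dimensional linear subspace.\<close>

definition standard_subsphere :: "nat \<Rightarrow> 'v::euclidean_space set \<Rightarrow> bool" where
  "standard_subsphere k S \<longleftrightarrow> (\<exists>V. subspace V \<and> dim V = k + 1 \<and> S = sphere 0 1 \<inter> V)"

lemma group_action_sphere_action:
  assumes "orthogonal_representation G \<rho>"
  shows "group_action G (sphere 0 1) (sphere_action \<rho>)"
proof -
  interpret group_action G UNIV \<rho>
    using assms by (simp add: orthogonal_representation_def)
  have nrm: "norm (\<rho> g x) = norm x" if "g \<in> carrier G" for g x
    using assms that by (simp add: orthogonal_representation_def orthogonal_transformation)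
  have G: "group G"
    using group_hom by (simp add: group_hom_def)
  have comp: "\<rho> (g \<otimes>\<^bsub>G\<^esub> h) x = \<rho> g (\<rho> h x)" if "g \<in> carrier G" "h \<in> carrier G" for g h x
    using that by (simp add: composition_rule)
  have bij: "sphere_action \<rho> g \<in> Bij (sphere 0 1)" if g: "g \<in> carrier G" for g
  proof -
    have "inj (\<rho> g)"
      using inj_prop g by blast
    moreover have "\<exists>y\<in>sphere 0 1. x = \<rho> g y" if "x \<in> sphere 0 1" for x
      using surj_prop[OF g] nrm[OF g] that by (metis UNIV_I imageE mem_sphere_0)
    ultimately have "bij_betw (sphere_action \<rho> g) (sphere 0 1) (sphere 0 1)"
      unfolding bij_betw_def sphere_action_def
      using nrm[OF g] by (auto simp: inj_on_def image_iff)
    then show ?thesis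
      by (simp add: Bij_def sphere_action_def)
  qed
  have "sphere_action \<rho> (g \<otimes>\<^bsub>G\<^esub> h)
      = compose (sphere 0 1) (sphere_action \<rho> g) (sphere_action \<rho> h)"
    if "g \<in> carrier G" "h \<in> carrier G" for g h
    using that by (auto simp: sphere_action_def compose_def fun_eq_iff comp nrm)
  then have "sphere_action \<rho> \<in> hom G (BijGroup (sphere 0 1))"
    using bij by (auto simp: hom_def BijGroup_def)
  then show ?thesis
    using G by (simp add: group_action_def group_hom_def group_hom_axioms_def group_BijGroup)
qed

end

(* Upper bounds. An equivariant planner on an invariant set is the same as an equivariant homotopy
   between the two projections, and geodesics give such a homotopy between any two nowhere
   antipodal equivariant maps. So one moves directly where x is not -y; through -y and then along an
   equivariant tangent field v where x is not y and v(y) is not 0; and through a fixed point e' where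
   neither x nor y is -e'. The field v(y) = e - <e, y> y, with e fixed and orthogonal to e', vanishes
   only at e and -e, which yields three sets. If n and k are odd there is a nowhere vanishing field
   v(y) = K y with K skew, injective and equivariant, and two sets suffice.

   Lower bounds. A single planner would contract the sphere. For two planners, restrict to a sphere
   X of even dimension m (the sphere itself or its fixed points). The planners deform the second
   projection X x X -> X to maps f and g such that at every point f or g agrees, locally, with the
   first projection p1. Subdividing chains gives (f, g)_* + (p1, p1)_* = (p1, g)_* + (f, p1)_*; in
   degree 2m the left hand side factors through H_2m(X) = 0, and the right hand side is id + swap.
   But swap cannot be -1 on H_2m(X x X): writing the punctured R^(m+1) x R^(m+1) as the union of the
   sets x != 0 and y != 0, an excision argument would make swap act on H_(2m+1) of it as the
   identity, whereas swap has degree (-1)^(m+1) = -1. *)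

theory Submission
  imports Defs "HOL-Homology.Homology"
begin

section \<open>Chain-level exchange of maps, and involutions on a union of two open sets\<close>

section \<open>Singular homology\<close>

lemma homologous_rel_set_mult:
  assumes "singular_relcycle p X S a" "singular_relcycle p X S b"
  shows "homologous_rel_set p X S a \<otimes>\<^bsub>relative_homology_group (int p) X S\<^esub> homologous_rel_set p X S b
       = homologous_rel_set p X S (a + b)"
proof -
  let ?R = "relcycle_group p X S" and ?N = "singular_relboundary_set p X S"
  have "(?N #>\<^bsub>?R\<^esub> a) <#>\<^bsub>?R\<^esub> (?N #>\<^bsub>?R\<^esub> b) = ?N #>\<^bsub>?R\<^esub> (a \<otimes>\<^bsub>?R\<^esub> b)"
    using assms normal.rcos_sum[OF normal_subgroup_singular_relboundary_relcycle] by simp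
  then show ?thesis
    by (simp add: right_coset_singular_relboundary relative_homology_group_def FactGroup_def)
qed

text \<open>After subdivision a class has a representative whose simplices each lie in
  \<open>A\<close> or in \<open>B\<close>. On such a simplex the pair (\<open>u\<close>,
  \<open>u'\<close>) equals the pair (\<open>v\<close>, \<open>v'\<close>) up to order, so the two
  sums agree already on chains.\<close>

lemma hom_induced_exchange:
  fixes X :: "'a topology" and Y :: "'b topology"
  assumes A: "openin X A" and B: "openin X B" and cover: "topspace X \<subseteq> A \<union> B"
    and cont: "continuous_map X Y u" "continuous_map X Y u'"
              "continuous_map X Y v" "continuous_map X Y v'"
    and eqA: "\<And>x. x \<in> A \<Longrightarrow> u x = v x \<and> u' x = v' x"
    and eqB: "\<And>x. x \<in> B \<Longrightarrow> u x = v' x \<and> u' x = v x"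
    and c: "c \<in> carrier (homology_group (int p) X)"
  shows "hom_induced (int p) X {} Y {} u c \<otimes>\<^bsub>homology_group (int p) Y\<^esub> hom_induced (int p) X {} Y {} u' c
       = hom_induced (int p) X {} Y {} v c \<otimes>\<^bsub>homology_group (int p) Y\<^esub> hom_induced (int p) X {} Y {} v' c"
proof -
  obtain a0 where a0: "singular_relcycle p X {} a0" "c = homologous_rel_set p X {} a0"
    using c by (auto simp: carrier_relative_homology_group)
  obtain a where a: "singular_relcycle p X {} a" and hom: "homologous_rel p X {} a0 a"
    and small: "\<And>f. f \<in> Poly_Mapping.keys a \<Longrightarrow> \<exists>V \<in> {A, B}. f \<in> standard_simplex p \<rightarrow> V"
    using small_homologous_rel_relcycle_exists[of "{A,B}" X p "{}" a0] a0(1) A B cover by auto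
  have ca: "c = homologous_rel_set p X {} a"
    using a0 hom by (simp add: homologous_rel_set_eq)
  have "Poly_Mapping.keys a \<subseteq> {f. f \<in> standard_simplex p \<rightarrow> A \<or> f \<in> standard_simplex p \<rightarrow> B}"
    using small by auto
  then have "chain_map p u a + chain_map p u' a = chain_map p v a + chain_map p v' a"
  proof (induction a rule: frag_induction)
    case (one f)
    then consider "f \<in> standard_simplex p \<rightarrow> A" | "f \<in> standard_simplex p \<rightarrow> B" by blast
    then show ?case
    proof cases
      case 1
      then have "simplex_map p u f = simplex_map p v f" "simplex_map p u' f = simplex_map p v' f"
        using eqA by (auto simp: simplex_map_def fun_eq_iff Pi_iff)
      then show ?thesis by simp
    next
      case 2
      then have "simplex_map p u f = simplex_map p v' f" "simplex_map p u' f = simplex_map p v f"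
        using eqB by (auto simp: simplex_map_def fun_eq_iff Pi_iff)
      then show ?thesis by simp
    qed
  next
    case (diff a b)
    then show ?case by (simp add: chain_map_diff algebra_simps)
  qed auto
  moreover have "singular_relcycle p Y {} (chain_map p f a)" if "continuous_map X Y f" for f
    using a that by (intro singular_relcycle_chain_map) auto
  moreover have "hom_induced (int p) X {} Y {} f c = homologous_rel_set p Y {} (chain_map p f a)"
    if "continuous_map X Y f" for f
    unfolding ca using a that by (intro hom_induced_chain_map) auto
  ultimately show ?thesis
    using cont by (simp add: homologous_rel_set_mult)
qed

lemma hom_induced_mult:
  assumes "a \<in> carrier (relative_homology_group p X S)" "b \<in> carrier (relative_homology_group p X S)"
  shows "hom_induced p X S Y T f (a \<otimes>\<^bsub>relative_homology_group p X S\<^esub> b)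
       = hom_induced p X S Y T f a \<otimes>\<^bsub>relative_homology_group p Y T\<^esub> hom_induced p X S Y T f b"
  using hom_mult[OF hom_induced_hom] assms by blast

text \<open>Since H_p(U) = 0, the map from H_p(P) to H_p(P, U) is injective. By excision the image
  of \<open>z\<close> there comes from a class of (V, U \<inter> V). Adding to that class its image
  under \<sigma> gives an invariant class of (P, U \<inter> V), whose boundary vanishes by
  \<open>antisym\<close>. It lifts to H_p(P), and the lift is \<open>z\<close> itself because
  \<sigma> moves V into U.\<close>

lemma hom_induced_involution_join:
  fixes P :: "'a topology"
  assumes U: "openin P U" and V: "openin P V" and cover: "topspace P = U \<union> V"
    and cont: "continuous_map P P \<sigma>" and UV: "\<sigma> \<in> U \<rightarrow> V" and VU: "\<sigma> \<in> V \<rightarrow> U"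
    and inv: "\<And>x. x \<in> topspace P \<Longrightarrow> \<sigma> (\<sigma> x) = x"
    and trivU: "trivial_group (homology_group p (subtopology P U))"
    and antisym: "\<And>n. n \<in> carrier (homology_group (p - 1) (subtopology P (U \<inter> V))) \<Longrightarrow>
        n \<otimes>\<^bsub>homology_group (p - 1) (subtopology P (U \<inter> V))\<^esub>
          hom_induced (p - 1) (subtopology P (U \<inter> V)) {} (subtopology P (U \<inter> V)) {} \<sigma> n
        = \<one>\<^bsub>homology_group (p - 1) (subtopology P (U \<inter> V))\<^esub>"
    and z: "z \<in> carrier (homology_group p P)"
  shows "hom_induced p P {} P {} \<sigma> z = z"
proof -
  define N where "N = U \<inter> V"
  let ?H = "relative_homology_group p P N"
  let ?HU = "relative_homology_group p P U"
  let ?j = "hom_induced p P {} P U id"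
  let ?k = "hom_induced p P {} P N id"
  let ?l = "hom_induced p P N P U id"
  let ?\<sigma> = "hom_induced p P {} P {} \<sigma>"
  let ?\<tau> = "hom_induced p P N P N \<sigma>"
  have sub: "U \<subseteq> topspace P" "V \<subseteq> topspace P"
    using U V openin_subset by auto
  have NN: "\<sigma> \<in> N \<rightarrow> N" using UV VU by (auto simp: N_def)
  interpret HH: comm_group ?H by simp
  interpret HU: comm_group ?HU by simp
  have lk: "?l (?k x) = ?j x" for x
    by (subst hom_induced_compose') (auto simp: N_def)
  \<comment> \<open>Excision of the complement of \<open>V\<close>, a closed set contained in the
    open set \<open>U\<close>.\<close>
  have iso: "hom_induced p (subtopology P V) N P U id
      \<in> iso (relative_homology_group p (subtopology P V) N) ?HU"
  proof -
    have 1: "topspace P - (topspace P - V) = V" "U - (topspace P - V) = N"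
      using sub by (auto simp: N_def)
    have cl: "closedin P (topspace P - V)"
      using V by blast
    have "hom_induced p (subtopology P (topspace P - (topspace P - V))) (U - (topspace P - V))
       (subtopology P (topspace P)) U id
      \<in> iso (relative_homology_group p (subtopology P (topspace P - (topspace P - V))) (U - (topspace P - V)))
         (relative_homology_group p (subtopology P (topspace P)) U)"
      apply (rule homology_excision_axiom)
      unfolding closure_of_closedin[OF cl] using U sub cover by (auto simp: interior_of_openin)
    then show ?thesis unfolding 1 by simp
  qed
  obtain \<zeta> where \<zeta>: "\<zeta> \<in> carrier (relative_homology_group p (subtopology P V) N)"
    and \<zeta>z: "hom_induced p (subtopology P V) N P U id \<zeta> = ?j z"
  proof -
    have "?j z \<in> hom_induced p (subtopology P V) N P U id ` carrier (relative_homology_group p (subtopology P V) N)"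
      using iso hom_induced_carrier[of p P "{}" P U id z] by (simp add: iso_def bij_betw_def)
    then show thesis using that by force
  qed
  define \<zeta>' where "\<zeta>' = hom_induced p (subtopology P V) N P N id \<zeta>"
  have \<zeta>'c: "\<zeta>' \<in> carrier ?H" by (simp add: \<zeta>'_def hom_induced_carrier)
  have \<tau>c: "?\<tau> \<zeta>' \<in> carrier ?H" by (simp add: hom_induced_carrier)
  have l\<zeta>: "?l \<zeta>' = ?j z"
    unfolding \<zeta>'_def using \<zeta>z by (subst hom_induced_compose') (auto simp: N_def)
  \<comment> \<open>\<sigma> carries the pair (V, N) into (U, U), whose relative homology is
    trivial.\<close>
  have l\<tau>: "?l (?\<tau> \<zeta>') = \<one>\<^bsub>?HU\<^esub>"
  proof -
    have c\<sigma>: "continuous_map (subtopology P V) (subtopology P U) \<sigma>"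
      using cont VU by (auto simp: continuous_map_in_subtopology continuous_map_from_subtopology)
    have "?l (?\<tau> \<zeta>') = hom_induced p (subtopology P V) N P U \<sigma> \<zeta>"
    proof -
      have "?l (?\<tau> \<zeta>') = hom_induced p P N P U (id \<circ> \<sigma>) \<zeta>'"
        using cont NN by (subst hom_induced_compose') (auto simp: N_def)
      also have "\<dots> = hom_induced p (subtopology P V) N P U ((id \<circ> \<sigma>) \<circ> id) \<zeta>"
        unfolding \<zeta>'_def using cont NN by (subst hom_induced_compose') (auto simp: N_def)
      finally show ?thesis by simp
    qed
    also have "\<dots> = hom_induced p (subtopology P U) U P U id
                       (hom_induced p (subtopology P V) N (subtopology P U) U \<sigma> \<zeta>)"
      using c\<sigma> NN by (subst hom_induced_compose') (auto simp: N_def)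
    also have "hom_induced p (subtopology P V) N (subtopology P U) U \<sigma> \<zeta>
         = \<one>\<^bsub>relative_homology_group p (subtopology P U) U\<^esub>"
      using trivial_relative_homology_group_topspace[of p "subtopology P U"] sub
        hom_induced_carrier[of p "subtopology P V" N "subtopology P U" U \<sigma> \<zeta>]
      by (simp add: trivial_group_def Int_absorb1)
    also have "hom_induced p (subtopology P U) U P U id \<dots> = \<one>\<^bsub>?HU\<^esub>"
      by (rule hom_one[OF hom_induced_hom]) auto
    finally show ?thesis .
  qed
  define w where "w = \<zeta>' \<otimes>\<^bsub>?H\<^esub> ?\<tau> \<zeta>'"
  have wc: "w \<in> carrier ?H" using \<zeta>'c \<tau>c by (simp add: w_def)
  \<comment> \<open>By naturality the boundary of \<open>w\<close> is the sum of the boundary of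
    \<open>\<zeta>'\<close> and of its image under \<sigma>.\<close>
  have "hom_boundary p P N w = \<one>\<^bsub>homology_group (p - 1) (subtopology P N)\<^esub>"
  proof -
    have "hom_boundary p P N (?\<tau> \<zeta>')
        = hom_induced (p - 1) (subtopology P N) {} (subtopology P N) {} \<sigma> (hom_boundary p P N \<zeta>')"
      using naturality_hom_induced[OF cont NN, of p] by (simp add: fun_eq_iff)
    then show ?thesis
      unfolding w_def hom_mult[OF hom_boundary_hom \<zeta>'c \<tau>c]
      using antisym[folded N_def, OF hom_boundary_carrier[of p P N \<zeta>']] by simp
  qed
  then have "w \<in> kernel ?H (homology_group (p - 1) (subtopology P N)) (hom_boundary p P N)"
    using wc by (simp add: kernel_def)
  then obtain y where y: "y \<in> carrier (homology_group p P)" "?k y = w"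
    using homology_exactness_axiom_1[of p P N] by auto
  have jinj: "inj_on ?j (carrier (homology_group p P))"
  proof -
    interpret g: group_hom "homology_group p P" ?HU ?j
      by (simp add: group_hom_def group_hom_axioms_def hom_induced_hom)
    have "kernel (homology_group p P) ?HU ?j =
       hom_induced p (subtopology P U) {} P {} id ` carrier (homology_group p (subtopology P U))"
      using homology_exactness_axiom_3[of p P U] by auto
    also have "\<dots> = {\<one>\<^bsub>homology_group p P\<^esub>}"
      using trivU hom_one[OF hom_induced_hom, of p "subtopology P U" "{}" P "{}" id]
      by (simp add: trivial_group_def)
    finally show ?thesis by (simp add: g.inj_iff_trivial_ker)
  qed
  have "?j y = ?l w" using y lk by metis
  also have "\<dots> = ?j z"
    unfolding w_def by (simp add: hom_induced_mult \<zeta>'c \<tau>c l\<zeta> l\<tau> hom_induced_carrier)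
  finally have "y = z" using jinj y(1) z by (meson inj_onD)
  \<comment> \<open>The map is an involution and the group is abelian, so the two summands of
    \<open>w\<close> change places.\<close>
  have "?\<tau> w = w"
  proof -
    have "?\<tau> (?\<tau> \<zeta>') = \<zeta>'"
      using cont NN \<zeta>'c inv
      by (simp add: hom_induced_compose' hom_induced_id_gen continuous_map_compose)
    then show ?thesis
      unfolding w_def by (simp add: hom_induced_mult \<zeta>'c \<tau>c HH.m_comm)
  qed
  have "?k (?\<sigma> y) = ?\<tau> (?k y)"
    using cont NN by (simp add: hom_induced_compose')
  then have "?k (?\<sigma> y) = ?k y" using \<open>?\<tau> w = w\<close> y by simp
  then have "?j (?\<sigma> y) = ?j y" using lk by metis
  then have "?\<sigma> y = y"
    using jinj y(1) hom_induced_carrier by (metis inj_onD)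
  then show ?thesis using \<open>y = z\<close> by simp
qed

section \<open>Homotopies, and the action of the swap on X x X under two planners\<close>

section \<open>Motion planners and the coordinate swap\<close>

text \<open>In \<open>homotopic_with\<close> the end maps are prescribed at every point, also
  outside \<open>S\<close>. A property that depends only on the values on \<open>S\<close> allows
  the ends to be checked on \<open>S\<close> alone.\<close>

lemma homotopic_with_canonI:
  assumes "\<And>h k. (\<And>x. x \<in> S \<Longrightarrow> h x = k x) \<Longrightarrow> (P h \<longleftrightarrow> P k)"
    and "continuous_on ({0..1::real} \<times> S) h"
    and "\<And>t x. \<lbrakk>0 \<le> t; t \<le> 1; x \<in> S\<rbrakk> \<Longrightarrow> h (t, x) \<in> T"
    and "\<And>x. x \<in> S \<Longrightarrow> h (0, x) = f x" "\<And>x. x \<in> S \<Longrightarrow> h (1, x) = g x"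
    and "\<And>t. \<lbrakk>0 \<le> t; t \<le> 1\<rbrakk> \<Longrightarrow> P (\<lambda>x. h (t, x))"
  shows "homotopic_with_canon P S T f g"
proof -
  have "continuous_map (prod_topology (top_of_set {0..1}) (top_of_set S)) (top_of_set T) h"
    using assms(2,3) by auto
  moreover have "homotopic_with_canon P S T f g \<longleftrightarrow>
      (\<exists>h. continuous_map (prod_topology (top_of_set {0..1::real}) (top_of_set S)) (top_of_set T) h \<and>
         (\<forall>x\<in>topspace (top_of_set S). h (0, x) = f x) \<and>
         (\<forall>x\<in>topspace (top_of_set S). h (1, x) = g x) \<and> (\<forall>t\<in>{0..1}. P (\<lambda>x. h (t, x))))"
    by (rule homotopic_with) (rule assms(1), simp)
  ultimately show ?thesis
    using assms(4-6) by (auto intro!: exI[where x = h])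
qed

lemma homotopic_with_canonD:
  assumes "homotopic_with_canon P S T f g"
  shows "\<exists>h. continuous_on ({0..1::real} \<times> S) h \<and> h \<in> {0..1} \<times> S \<rightarrow> T \<and>
    (\<forall>x. h (0, x) = f x) \<and> (\<forall>x. h (1, x) = g x) \<and> (\<forall>t\<in>{0..1}. P (\<lambda>x. h (t, x)))"
  using assms unfolding homotopic_with_def by simp

lemma homotopic_with_pair:
  assumes "homotopic_with (\<lambda>_. True) Z X f f'" "homotopic_with (\<lambda>_. True) Z Y g g'"
  shows "homotopic_with (\<lambda>_. True) Z (prod_topology X Y) (\<lambda>z. (f z, g z)) (\<lambda>z. (f' z, g' z))"
proof -
  obtain h k where "continuous_map (prod_topology (top_of_set {0..1::real}) Z) X h"
      "\<forall>x. h (0, x) = f x" "\<forall>x. h (1, x) = f' x"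
      "continuous_map (prod_topology (top_of_set {0..1::real}) Z) Y k"
      "\<forall>x. k (0, x) = g x" "\<forall>x. k (1, x) = g' x"
    using assms unfolding homotopic_with_def by auto
  then show ?thesis
    unfolding homotopic_with_def
    by (intro exI[where x = "\<lambda>z. (h z, k z)"] conjI continuous_map_pairedI) auto
qed

text \<open>The given homotopy is run only up to the time \<open>l (\<phi> z)\<close>, which
  vanishes near the complement of \<open>V\<close>. So it can be glued to the constant homotopy at
  \<open>b\<close>.\<close>

lemma extend_partial_deformation:
  fixes b :: "'a::topological_space \<Rightarrow> 'b::topological_space" and \<phi> :: "'a \<Rightarrow> real"
  assumes b: "continuous_on Z b" "b \<in> Z \<rightarrow> X" and hom: "homotopic_with_canon (\<lambda>_. True) V X b a"
    and V: "openin (top_of_set Z) V" and \<phi>: "continuous_on Z \<phi>"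
    and supp: "\<And>z. \<lbrakk>z \<in> Z; 0 < \<phi> z\<rbrakk> \<Longrightarrow> z \<in> V"
  obtains f where "homotopic_with_canon (\<lambda>_. True) Z X b f"
    "\<And>z. \<lbrakk>z \<in> Z; 1/3 < \<phi> z\<rbrakk> \<Longrightarrow> f z = a z"
proof -
  obtain h where h: "continuous_on ({0..1::real} \<times> V) h"
    and hX: "h \<in> {0..1} \<times> V \<rightarrow> X"
    and h0: "\<And>x. h (0, x) = b x" and h1: "\<And>x. h (1, x) = a x"
    using homotopic_with_canonD[OF hom] by auto
  have VZ: "V \<subseteq> Z" using V openin_imp_subset by blast
  \<comment> \<open>The affine function is 0 at 1/4 and 1 at 1/3; clamping keeps the time in the
    unit interval.\<close>
  define l where "l s = min 1 (max 0 (12 * s - 3))" for s :: real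
  have l: "0 \<le> l s" "l s \<le> 1" "s \<le> 1/4 \<Longrightarrow> l s = 0" "1/3 < s \<Longrightarrow> l s = 1" for s
    by (auto simp: l_def)
  define F where "F = (\<lambda>(t, z). if z \<in> V then h (t * l (\<phi> z), z) else b z)"
  \<comment> \<open>\<open>B\<close> and \<open>V\<close> cover \<open>Z\<close> by
    \<open>supp\<close>, both are open, and on their overlap the running time is 0, so both formulas
    give \<open>b\<close>.\<close>
  define B where "B = {z \<in> Z. \<phi> z < 1/4}"
  have Z: "Z = V \<union> B" using VZ supp by (force simp: B_def)
  have B: "openin (top_of_set Z) B"
  proof -
    have "B = Z \<inter> \<phi> -` {..<1/4}" by (auto simp: B_def)
    then show ?thesis using continuous_openin_preimage_gen[OF \<phi>, of "{..<1/4}"] by simp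
  qed
  have cF: "continuous_on ({0..1} \<times> V \<union> {0..1} \<times> B)
    (\<lambda>p. if snd p \<in> V then h (fst p * l (\<phi> (snd p)), snd p) else b (snd p))"
  proof (rule continuous_on_cases_local_open)
    show "openin (top_of_set ({0..1::real} \<times> V \<union> {0..1} \<times> B)) ({0..1} \<times> V)"
      "openin (top_of_set ({0..1::real} \<times> V \<union> {0..1} \<times> B)) ({0..1} \<times> B)"
      using V B Z by (auto simp flip: Sigma_Un_distrib2 intro!: openin_Times)
    have "continuous_on ({0..1} \<times> V) (\<lambda>p. (fst p * l (\<phi> (snd p)), snd p))"
      unfolding l_def using VZ
      by (intro continuous_intros continuous_on_compose2[OF \<phi>]) auto
    moreover have "(\<lambda>p. (fst p * l (\<phi> (snd p)), snd p)) ` ({0..1} \<times> V) \<subseteq> {0..1} \<times> V"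
      using l by (auto simp: mult_le_one)
    ultimately show "continuous_on ({0..1} \<times> V) (\<lambda>p. h (fst p * l (\<phi> (snd p)), snd p))"
      by (rule continuous_on_compose2[OF h])
    show "continuous_on ({0..1} \<times> B) (\<lambda>p. b (snd p))"
      by (intro continuous_intros continuous_on_compose2[OF b(1)]) (auto simp: B_def)
    fix p :: "real \<times> 'a"
    assume "p \<in> {0..1} \<times> V \<and> snd p \<notin> V \<or> p \<in> {0..1} \<times> B \<and> snd p \<in> V"
    then show "h (fst p * l (\<phi> (snd p)), snd p) = b (snd p)"
      using l(3) by (auto simp: B_def h0)
  qed
  have Z01: "{0..1} \<times> V \<union> {0..1} \<times> B = {0..1::real} \<times> Z" using Z by auto
  have F_eq: "(\<lambda>p. if snd p \<in> V then h (fst p * l (\<phi> (snd p)), snd p) else b (snd p)) = F"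
    by (auto simp: F_def fun_eq_iff)
  have F: "continuous_on ({0..1} \<times> Z) F"
    using cF unfolding Z01 F_eq .
  show thesis
  proof
    show "homotopic_with_canon (\<lambda>_. True) Z X b (\<lambda>z. F (1, z))"
    proof (rule homotopic_with_canonI[where h = F])
      show "F (t, x) \<in> X" if "0 \<le> t" "t \<le> 1" "x \<in> Z" for t x
      proof (cases "x \<in> V")
        case True
        then have "(t * l (\<phi> x), x) \<in> {0..1} \<times> V" using l that by (simp add: mult_le_one)
        then show ?thesis using True funcset_mem[OF hX] by (simp add: F_def)
      next
        case False
        then show ?thesis using that b(2) by (auto simp: F_def)
      qed
      show "F (0, x) = b x" for x by (simp add: F_def h0)
    qed (use F in auto)
    show "F (1, z) = a z" if "z \<in> Z" "1/3 < \<phi> z" for z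
      using that l(4) supp by (simp add: F_def h1)
  qed
qed

lemma hom_induced_through_trivial:
  assumes "continuous_map X T f" "continuous_map T Y g" "trivial_group (homology_group p T)"
  shows "hom_induced p X {} Y {} (g \<circ> f) c = \<one>\<^bsub>homology_group p Y\<^esub>"
proof -
  have "hom_induced p X {} T {} f c = \<one>\<^bsub>homology_group p T\<^esub>"
    using assms(3) hom_induced_carrier[of p X "{}" T "{}" f c] by (simp add: trivial_group_def)
  then show ?thesis
    using assms hom_one[OF hom_induced_hom, of p T "{}" Y "{}" g]
    by (simp add: hom_induced_compose_empty)
qed

text \<open>Each planner yields a deformation of \<open>snd\<close> that equals \<open>fst\<close>
  on an open set, and these two open sets cover X x X. Of the four self-maps in the exchange
  relation, (f, g) deforms to (snd, snd), so that it and (fst, fst) factor through the diagonal and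
  vanish; (fst, g) deforms to the identity and (f, fst) to the swap.\<close>

lemma swap_homology_two_planners:
  fixes X :: "'a::euclidean_space set"
  assumes U: "openin (top_of_set (X \<times> X)) U1" "openin (top_of_set (X \<times> X)) U2"
    and cover: "X \<times> X = U1 \<union> U2"
    and hom: "homotopic_with_canon (\<lambda>_. True) U1 X fst snd" "homotopic_with_canon (\<lambda>_. True) U2 X fst snd"
    and triv: "trivial_group (homology_group (int p) (top_of_set X))"
    and c: "c \<in> carrier (homology_group (int p) (top_of_set (X \<times> X)))"
  shows "c \<otimes>\<^bsub>homology_group (int p) (top_of_set (X \<times> X))\<^esub>
      hom_induced (int p) (top_of_set (X \<times> X)) {} (top_of_set (X \<times> X)) {} prod.swap c
    = \<one>\<^bsub>homology_group (int p) (top_of_set (X \<times> X))\<^esub>"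
proof -
  let ?Z = "top_of_set (X \<times> X)" and ?T = "top_of_set X"
  let ?G = "homology_group (int p) ?Z"
  let ?H = "\<lambda>f. hom_induced (int p) ?Z {} ?Z {} f c"
  interpret G: group ?G by simp
  have ZT: "?Z = prod_topology ?T ?T"
    by simp
  have cl: "closedin (top_of_set (X \<times> X)) (X \<times> X - U1)" "closedin (top_of_set (X \<times> X)) (X \<times> X - U2)"
    using U by auto
  have dis: "(X \<times> X - U1) \<inter> (X \<times> X - U2) = {}" using cover by auto
  obtain \<phi> :: "'a \<times> 'a \<Rightarrow> real" where \<phi>: "continuous_on (X \<times> X) \<phi>"
    and \<phi>0: "\<And>z. z \<in> X \<times> X - U1 \<Longrightarrow> \<phi> z = 0" and \<phi>1: "\<And>z. z \<in> X \<times> X - U2 \<Longrightarrow> \<phi> z = 1"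
    using Urysohn_local[OF cl dis, of 0 "1::real"] by metis
  have snd: "continuous_on (X \<times> X) snd" "snd \<in> X \<times> X \<rightarrow> X" by (auto intro!: continuous_intros)
  obtain f where f: "homotopic_with_canon (\<lambda>_. True) (X \<times> X) X snd f"
    and fA: "\<And>z. \<lbrakk>z \<in> X \<times> X; 1/3 < \<phi> z\<rbrakk> \<Longrightarrow> f z = fst z"
  proof (rule extend_partial_deformation[OF snd homotopic_with_symD[OF hom(1)] U(1) \<phi>])
    show "z \<in> U1" if "z \<in> X \<times> X" "0 < \<phi> z" for z
      using that \<phi>0 by force
  qed (rule that)
  obtain g where g: "homotopic_with_canon (\<lambda>_. True) (X \<times> X) X snd g"
    and gB: "\<And>z. \<lbrakk>z \<in> X \<times> X; 1/3 < 1 - \<phi> z\<rbrakk> \<Longrightarrow> g z = fst z"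
  proof (rule extend_partial_deformation[OF snd homotopic_with_symD[OF hom(2)] U(2), of "\<lambda>z. 1 - \<phi> z"])
    show "continuous_on (X \<times> X) (\<lambda>z. 1 - \<phi> z)"
      using \<phi> by (intro continuous_intros)
    show "z \<in> U2" if "z \<in> X \<times> X" "0 < 1 - \<phi> z" for z
      using that \<phi>1 by force
  qed (rule that)
  \<comment> \<open>The thresholds overlap: every value of \<phi> is above 1/3 or below 2/3, so
    \<open>A\<close> and \<open>B\<close> cover X x X.\<close>
  define A where "A = {z \<in> X \<times> X. 1/3 < \<phi> z}"
  define B where "B = {z \<in> X \<times> X. 1/3 < 1 - \<phi> z}"
  have op: "openin ?Z A" "openin ?Z B"
  proof -
    have "A = X \<times> X \<inter> \<phi> -` {1/3<..}" "B = X \<times> X \<inter> \<phi> -` {..<2/3}" by (auto simp: A_def B_def)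
    then show "openin ?Z A" "openin ?Z B"
      using continuous_openin_preimage_gen[OF \<phi>, of "{1/3<..}"]
        continuous_openin_preimage_gen[OF \<phi>, of "{..<2/3}"] by auto
  qed
  have fstT: "continuous_map ?Z ?T fst" and sndT: "continuous_map ?Z ?T snd"
    unfolding ZT by (rule continuous_map_fst continuous_map_snd)+
  have fT: "continuous_map ?Z ?T f" and gT: "continuous_map ?Z ?T g"
    using f g homotopic_with_imp_continuous_maps by blast+
  have pair: "continuous_map ?Z ?Z (\<lambda>z. (a z, b z))" if "continuous_map ?Z ?T a" "continuous_map ?Z ?T b" for a b
    using that by (subst (2) ZT) (rule continuous_map_pairedI)
  have hpair: "?H (\<lambda>z. (a z, b z)) = ?H (\<lambda>z. (a' z, b' z))"
    if "homotopic_with (\<lambda>_. True) ?Z ?T a a'" "homotopic_with (\<lambda>_. True) ?Z ?T b b'" for a b a' b'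
    using homology_homotopy_empty[OF homotopic_with_pair[OF that], folded ZT] by simp
  have diag: "?H (\<lambda>z. (a z, a z)) = \<one>\<^bsub>?G\<^esub>" if a: "continuous_map ?Z ?T a" for a
  proof -
    have "continuous_map ?T ?Z (\<lambda>x. (x, x))" unfolding ZT by (intro continuous_map_pairedI) auto
    from hom_induced_through_trivial[OF a this triv] show ?thesis by (simp add: o_def)
  qed
  have refl: "homotopic_with (\<lambda>_. True) ?Z ?T fst fst"
    using fstT by simp
  have swap: "prod.swap = (\<lambda>z :: 'a \<times> 'a. (snd z, fst z))"
    by (rule ext) (simp add: prod_eq_iff)
  \<comment> \<open>On \<open>A\<close> the equality f = fst matches the maps in the given order; on
    \<open>B\<close> the equality g = fst matches them crosswise.\<close>
  have E: "?H (\<lambda>z. (f z, g z)) \<otimes>\<^bsub>?G\<^esub> ?H (\<lambda>z. (fst z, fst z))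
      = ?H (\<lambda>z. (fst z, g z)) \<otimes>\<^bsub>?G\<^esub> ?H (\<lambda>z. (f z, fst z))"
    by (rule hom_induced_exchange[OF op _ pair[OF fT gT] pair[OF fstT fstT] pair[OF fstT gT] pair[OF fT fstT] _ _ c])
       (use fA gB in \<open>force simp: A_def B_def\<close>)+
  have E1: "?H (\<lambda>z. (f z, g z)) = \<one>\<^bsub>?G\<^esub>"
    using hpair[OF homotopic_with_symD[OF f] homotopic_with_symD[OF g]] diag[OF sndT] by simp
  have E2: "?H (\<lambda>z. (fst z, g z)) = c"
    using hpair[OF refl homotopic_with_symD[OF g]] c by (simp add: hom_induced_id_gen)
  have E3: "?H (\<lambda>z. (f z, fst z)) = ?H prod.swap"
    using hpair[OF homotopic_with_symD[OF f] refl] unfolding swap .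
  show ?thesis
    using E[unfolded E1 E2 E3 diag[OF fstT]] G.l_one[OF G.one_closed] by metis
qed

section \<open>Degrees of coordinate reflections\<close>

section \<open>Spheres of even dimension\<close>

lemma continuous_map_nsphere_transpose:
  assumes "a \<le> p" "b \<le> p"
  shows "continuous_map (nsphere p) (nsphere p) (\<lambda>x i. x (Transposition.transpose a b i))"
proof -
  have "(\<Sum>i\<le>p. (x (Transposition.transpose a b i))\<^sup>2) = (\<Sum>i\<le>p. (x i)\<^sup>2)" for x :: "nat \<Rightarrow> real"
    by (rule sum.reindex_bij_betw[where g = "\<lambda>i. (x i)\<^sup>2"])
       (use assms in simp)
  moreover have "Transposition.transpose a b i = i" if "i > p" for i
    using that assms by simp
  moreover have "continuous_map (nsphere p) euclideanreal (\<lambda>x. x (Transposition.transpose a b i))" for i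
    by (rule continuous_map_nsphere_projection)
  ultimately show ?thesis
    by (subst (2) nsphere) (auto simp: continuous_map_in_subtopology continuous_map_componentwise_UNIV nsphere)
qed

text \<open>This reflection is conjugate to the one in coordinate 0 by the transposition of
  coordinates 0 and k. The transposition is an involution, so its degree squares to 1 and
  cancels.\<close>

lemma Brouwer_degree2_reflection_coord:
  assumes "k \<le> p"
  shows "Brouwer_degree2 p (\<lambda>x i. if i = k then - x i else x i) = -1"
proof -
  define s where "s = (\<lambda>x :: nat \<Rightarrow> real. \<lambda>i. x (Transposition.transpose 0 k i))"
  define r where "r = (\<lambda>x :: nat \<Rightarrow> real. \<lambda>i. if i = 0 then - x i else x i)"
  have s: "continuous_map (nsphere p) (nsphere p) s"
    unfolding s_def using assms by (intro continuous_map_nsphere_transpose) auto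
  have r: "continuous_map (nsphere p) (nsphere p) r"
    unfolding r_def by (rule continuous_map_nsphere_reflection)
  have "s \<circ> s = id" by (simp add: s_def fun_eq_iff)
  then have ss: "Brouwer_degree2 p s * Brouwer_degree2 p s = 1"
    using Brouwer_degree2_compose[OF s s] by simp
  have "(\<lambda>x i. if i = k then - x i else x i) = s \<circ> (r \<circ> s)"
    by (auto simp: s_def r_def fun_eq_iff Transposition.transpose_def)
  then show ?thesis
    using Brouwer_degree2_compose[OF continuous_map_compose[OF s r] s] Brouwer_degree2_compose[OF s r]
      ss Brouwer_degree2_reflection[of p, folded r_def]
    by (simp add: mult.commute)
qed

text \<open>Reflections in distinct coordinates are composed one at a time. Continuity is carried
  through the induction because multiplicativity of the degree requires it.\<close>

lemma Brouwer_degree2_reflections: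
  assumes "finite A" "A \<subseteq> {..p}"
  shows "continuous_map (nsphere p) (nsphere p) (\<lambda>x i. if i \<in> A then - x i else x i) \<and>
    Brouwer_degree2 p (\<lambda>x i. if i \<in> A then - x i else x i) = (-1) ^ card A"
  using assms
proof (induction rule: finite_induct)
  case empty
  have "(\<lambda>x i. if i \<in> {} then - x i else x i) = (id :: (nat \<Rightarrow> real) \<Rightarrow> _)" by auto
  then show ?case by (simp only: Brouwer_degree2_id card.empty power_0 continuous_map_id simp_thms)
next
  case (insert k A)
  let ?r = "\<lambda>x :: nat \<Rightarrow> real. \<lambda>i. if i = k then - x i else x i"
  let ?a = "\<lambda>x :: nat \<Rightarrow> real. \<lambda>i. if i \<in> A then - x i else x i"
  have eq: "(\<lambda>x i. if i \<in> insert k A then - x i else x i) = ?r \<circ> ?a"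
    using insert.hyps by (auto simp: fun_eq_iff)
  have r: "continuous_map (nsphere p) (nsphere p) ?r"
    by (rule continuous_map_nsphere_reflection)
  have a: "continuous_map (nsphere p) (nsphere p) ?a" and da: "Brouwer_degree2 p ?a = (-1) ^ card A"
    using insert by auto
  have k: "k \<le> p" using insert.prems by simp
  show ?case
    unfolding eq using continuous_map_compose[OF a r] Brouwer_degree2_compose[OF a r]
      Brouwer_degree2_reflection_coord[OF k] da insert.hyps by simp
qed

section \<open>Homology of spheres and of products of punctured subspaces\<close>

lemma trivial_homology_group_deformation:
  assumes f: "continuous_map X Y f" and g: "continuous_map Y X g"
    and hom: "homotopic_with (\<lambda>_. True) X X (g \<circ> f) id"
    and triv: "trivial_group (homology_group p Y)"
  shows "trivial_group (homology_group p X)"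
proof -
  \<comment> \<open>The identity of H_p(X) factors through the trivial group H_p(Y).\<close>
  have "c = \<one>\<^bsub>homology_group p X\<^esub>" if c: "c \<in> carrier (homology_group p X)" for c
    using homology_homotopy_empty[OF hom, of p] hom_induced_through_trivial[OF f g triv, of c]
      hom_induced_id[OF c] by simp
  moreover have "\<one>\<^bsub>homology_group p X\<^esub> \<in> carrier (homology_group p X)"
    by (simp add: group.is_monoid)
  ultimately show ?thesis
    unfolding trivial_group_def using group_relative_homology_group by blast
qed

text \<open>An orthonormal basis of \<open>W\<close> identifies its unit sphere with
  \<open>nsphere m\<close>, whose reduced homology is concentrated in degree m. Outside degree 0
  reduced and ordinary homology agree.\<close>

lemma trivial_homology_group_subspace_sphere:
  fixes W :: "'a::euclidean_space set"
  assumes "subspace W" "dim W = m + 1" "q \<noteq> 0" "q \<noteq> int m"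
  shows "trivial_group (homology_group q (top_of_set (sphere 0 1 \<inter> W)))"
proof -
  obtain B where B: "B \<subseteq> W" "pairwise orthogonal B" "\<And>x. x \<in> B \<Longrightarrow> norm x = 1"
      "independent B" "card B = dim W" "span B = W"
    using orthonormal_basis_subspace[OF assms(1)] by metis
  obtain f g where "homeomorphic_maps (nsphere (m + 1 - 1)) (top_of_set (sphere 0 1 \<inter> span B)) f g"
    using homeomorphic_maps_nsphere_euclidean_sphere[OF B(4,2) _ _ B(3), of "m + 1"] B(5) assms(2) by auto
  then have "nsphere m homeomorphic_space top_of_set (sphere 0 1 \<inter> W)"
    using B(6) homeomorphic_maps_imp_homeomorphic_space by auto
  then have "homology_group q (nsphere m) \<cong> homology_group q (top_of_set (sphere 0 1 \<inter> W))"
    by (rule homeomorphic_space_imp_isomorphic_homology_groups)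
  moreover have "trivial_group (homology_group q (nsphere m))"
    using reduced_homology_group_nsphere(2)[OF assms(4)] un_reduced_homology_group[OF assms(3)] by metis
  ultimately show ?thesis
    by (metis group_relative_homology_group isomorphic_group_triviality)
qed

text \<open>The scalar runs from 1 / norm x to 1 without vanishing: this is the radial homotopy from
  normalisation to the identity.\<close>

lemma normalize_subspace_homotopy:
  fixes x :: "'a::real_normed_vector"
  assumes "subspace W" "x \<in> W - {0}" "0 \<le> t" "t \<le> 1"
  shows "((1 - t) / norm x + t) *\<^sub>R x \<in> W - {0}"
proof -
  have "(1 - t) / norm x + t \<noteq> 0"
  proof (cases "t = 1")
    case False
    then have "0 < (1 - t) / norm x" using assms by simp
    then show ?thesis using assms(3) by linarith
  qed simp
  then show ?thesis using assms subspace_scale by auto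
qed

lemma normalize_in_sphere:
  assumes "subspace W" "x \<in> W - {0}"
  shows "x /\<^sub>R norm x \<in> sphere 0 1 \<inter> W"
  using assms by (auto simp: subspace_scale)

text \<open>Normalising the first factor radially and shrinking the second linearly to 0 deforms the
  product to a copy of the sphere.\<close>

lemma trivial_homology_group_punctured_subspace_times:
  fixes W :: "'a::euclidean_space set"
  assumes W: "subspace W" and triv: "trivial_group (homology_group q (top_of_set (sphere 0 1 \<inter> W)))"
  shows "trivial_group (homology_group q (top_of_set ((W - {0}) \<times> W)))"
proof (rule trivial_homology_group_deformation[OF _ _ _ triv])
  let ?U = "(W - {0}) \<times> W" and ?X = "sphere 0 1 \<inter> W"
  have "continuous_on ?U (\<lambda>z. fst z /\<^sub>R norm (fst z))"
    by (auto intro!: continuous_intros)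
  moreover have "(\<lambda>z. fst z /\<^sub>R norm (fst z)) \<in> ?U \<rightarrow> ?X"
    by (intro Pi_I normalize_in_sphere[OF W]) auto
  ultimately show "continuous_map (top_of_set ?U) (top_of_set ?X) (\<lambda>z. fst z /\<^sub>R norm (fst z))"
    by simp
  show "continuous_map (top_of_set ?X) (top_of_set ?U) (\<lambda>x. (x, 0))"
    using W by (auto simp: subspace_0 intro!: continuous_intros)
  show "homotopic_with_canon (\<lambda>_. True) ?U ?U ((\<lambda>x. (x, 0)) \<circ> (\<lambda>z. fst z /\<^sub>R norm (fst z))) id"
  proof (rule homotopic_with_canonI[where h = "\<lambda>p. (((1 - fst p) / norm (fst (snd p)) + fst p) *\<^sub>R fst (snd p), fst p *\<^sub>R snd (snd p))"])
    show "continuous_on ({0..1} \<times> ?U) (\<lambda>p. (((1 - fst p) / norm (fst (snd p)) + fst p) *\<^sub>R fst (snd p), fst p *\<^sub>R snd (snd p)))"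
      by (auto intro!: continuous_intros)
    fix t :: real and z :: "'a \<times> 'a" assume "0 \<le> t" "t \<le> 1" "z \<in> ?U"
    then show "(((1 - fst (t, z)) / norm (fst (snd (t, z))) + fst (t, z)) *\<^sub>R fst (snd (t, z)), fst (t, z) *\<^sub>R snd (snd (t, z))) \<in> ?U"
      using normalize_subspace_homotopy[OF W, of "fst z" t] W by (auto simp: subspace_scale)
  qed (auto simp: inverse_eq_divide)
qed

text \<open>The inclusion of the product of spheres commutes with the swap. By radial normalisation
  it is onto in homology, so the relation carries over.\<close>

lemma swap_homology_punctured_subspace:
  fixes W :: "'a::euclidean_space set"
  assumes W: "subspace W"
    and X: "\<And>c. c \<in> carrier (homology_group q (top_of_set ((sphere 0 1 \<inter> W) \<times> (sphere 0 1 \<inter> W)))) \<Longrightarrow>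
      c \<otimes>\<^bsub>homology_group q (top_of_set ((sphere 0 1 \<inter> W) \<times> (sphere 0 1 \<inter> W)))\<^esub>
      hom_induced q (top_of_set ((sphere 0 1 \<inter> W) \<times> (sphere 0 1 \<inter> W))) {}
        (top_of_set ((sphere 0 1 \<inter> W) \<times> (sphere 0 1 \<inter> W))) {} prod.swap c
      = \<one>\<^bsub>homology_group q (top_of_set ((sphere 0 1 \<inter> W) \<times> (sphere 0 1 \<inter> W)))\<^esub>"
    and n: "n \<in> carrier (homology_group q (top_of_set ((W - {0}) \<times> (W - {0}))))"
  shows "n \<otimes>\<^bsub>homology_group q (top_of_set ((W - {0}) \<times> (W - {0})))\<^esub>
      hom_induced q (top_of_set ((W - {0}) \<times> (W - {0}))) {} (top_of_set ((W - {0}) \<times> (W - {0}))) {} prod.swap n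
      = \<one>\<^bsub>homology_group q (top_of_set ((W - {0}) \<times> (W - {0})))\<^esub>"
proof -
  define N where "N = (W - {0}) \<times> (W - {0})"
  define Y where "Y = (sphere 0 1 \<inter> W) \<times> (sphere 0 1 \<inter> W)"
  note X = X[folded Y_def] and n = n[folded N_def]
  define R where "R = (\<lambda>z :: 'a \<times> 'a. (fst z /\<^sub>R norm (fst z), snd z /\<^sub>R norm (snd z)))"
  have "continuous_on N R"
    by (auto simp: N_def R_def intro!: continuous_intros)
  moreover have "R \<in> N \<rightarrow> Y"
    unfolding N_def Y_def R_def by (intro Pi_I SigmaI normalize_in_sphere[OF W]) auto
  ultimately have R: "continuous_map (top_of_set N) (top_of_set Y) R" by simp
  have I: "continuous_map (top_of_set Y) (top_of_set N) id"
    by (auto simp: N_def Y_def)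
  have sY: "continuous_map (top_of_set Y) (top_of_set Y) prod.swap"
    by (auto simp: Y_def intro!: continuous_on_swap)
  have sN: "continuous_map (top_of_set N) (top_of_set N) prod.swap"
    by (auto simp: N_def intro!: continuous_on_swap)
  let ?HY = "homology_group q (top_of_set Y)" and ?HN = "homology_group q (top_of_set N)"
  let ?R = "hom_induced q (top_of_set N) {} (top_of_set Y) {} R"
  let ?I = "hom_induced q (top_of_set Y) {} (top_of_set N) {} id"
  let ?sY = "hom_induced q (top_of_set Y) {} (top_of_set Y) {} prod.swap"
  let ?sN = "hom_induced q (top_of_set N) {} (top_of_set N) {} prod.swap"
  have hom: "homotopic_with_canon (\<lambda>_. True) N N (id \<circ> R) id"
  proof (rule homotopic_with_canonI[where h = "\<lambda>p. (((1 - fst p) / norm (fst (snd p)) + fst p) *\<^sub>R fst (snd p),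
      ((1 - fst p) / norm (snd (snd p)) + fst p) *\<^sub>R snd (snd p))"])
    show "continuous_on ({0..1} \<times> N) (\<lambda>p. (((1 - fst p) / norm (fst (snd p)) + fst p) *\<^sub>R fst (snd p),
      ((1 - fst p) / norm (snd (snd p)) + fst p) *\<^sub>R snd (snd p)))"
      by (auto simp: N_def intro!: continuous_intros)
    fix t :: real and z :: "'a \<times> 'a" assume "0 \<le> t" "t \<le> 1" "z \<in> N"
    then show "(((1 - fst (t, z)) / norm (fst (snd (t, z))) + fst (t, z)) *\<^sub>R fst (snd (t, z)),
      ((1 - fst (t, z)) / norm (snd (snd (t, z))) + fst (t, z)) *\<^sub>R snd (snd (t, z))) \<in> N"
      using normalize_subspace_homotopy[OF W, of "fst z" t] normalize_subspace_homotopy[OF W, of "snd z" t]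
      by (auto simp: N_def)
  qed (auto simp: inverse_eq_divide R_def)
  have IR: "?I (?R n) = n"
    using homology_homotopy_empty[OF hom, of q] hom_induced_compose_empty[OF R I, of q] hom_induced_id[OF n]
    by (simp add: fun_eq_iff)
  have "hom_induced q (top_of_set Y) {} (top_of_set N) {} (id \<circ> prod.swap)
      = hom_induced q (top_of_set Y) {} (top_of_set N) {} (prod.swap \<circ> id)" by simp
  then have Is: "?I (?sY x) = ?sN (?I x)" for x
    unfolding hom_induced_compose_empty[OF sY I] hom_induced_compose_empty[OF I sN] by (simp add: fun_eq_iff)
  have Rn: "?R n \<in> carrier ?HY" by (rule hom_induced_carrier)
  have sRn: "?sY (?R n) \<in> carrier ?HY" by (rule hom_induced_carrier)
  have "?I (?R n) \<otimes>\<^bsub>?HN\<^esub> ?I (?sY (?R n)) = ?I (\<one>\<^bsub>?HY\<^esub>)"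
    unfolding X[OF Rn, symmetric] by (rule hom_induced_mult[OF Rn sRn, symmetric])
  also have "\<dots> = \<one>\<^bsub>?HN\<^esub>"
    by (rule hom_one[OF hom_induced_hom]) auto
  finally have "n \<otimes>\<^bsub>?HN\<^esub> ?sN n = \<one>\<^bsub>?HN\<^esub>" unfolding Is IR .
  then show ?thesis unfolding N_def .
qed

text \<open>The punctured square is the union of the open sets x \<noteq> 0 and y \<noteq> 0, which
  the swap interchanges and which meet in a product of two punctured subspaces. This is the
  situation of \<open>hom_induced_involution_join\<close>.\<close>

lemma hom_induced_swap_punctured_square:
  fixes W :: "'a::euclidean_space set"
  assumes W: "subspace W"
    and triv: "trivial_group (homology_group p (top_of_set ((W - {0}) \<times> W)))"
    and anti: "\<And>n. n \<in> carrier (homology_group (p - 1) (top_of_set ((W - {0}) \<times> (W - {0})))) \<Longrightarrow>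
      n \<otimes>\<^bsub>homology_group (p - 1) (top_of_set ((W - {0}) \<times> (W - {0})))\<^esub>
      hom_induced (p - 1) (top_of_set ((W - {0}) \<times> (W - {0}))) {} (top_of_set ((W - {0}) \<times> (W - {0}))) {} prod.swap n
      = \<one>\<^bsub>homology_group (p - 1) (top_of_set ((W - {0}) \<times> (W - {0})))\<^esub>"
    and z: "z \<in> carrier (homology_group p (top_of_set (W \<times> W - {0})))"
  shows "hom_induced p (top_of_set (W \<times> W - {0})) {} (top_of_set (W \<times> W - {0})) {} prod.swap z = z"
proof -
  define P where "P = W \<times> W - {0}"
  define U where "U = (W - {0}) \<times> W"
  define V where "V = W \<times> (W - {0})"
  have NUV: "U \<inter> V = (W - {0}) \<times> (W - {0})" by (auto simp: U_def V_def)
  have PUV: "P = U \<union> V" by (auto simp: P_def U_def V_def zero_prod_def)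
  have sub: "subtopology (top_of_set P) U = top_of_set U"
    "subtopology (top_of_set P) (U \<inter> V) = top_of_set (U \<inter> V)"
  proof -
    have "P \<inter> U = U" "P \<inter> (U \<inter> V) = U \<inter> V" using PUV by auto
    then show "subtopology (top_of_set P) U = top_of_set U"
      "subtopology (top_of_set P) (U \<inter> V) = top_of_set (U \<inter> V)"
      by (simp_all only: subtopology_subtopology)
  qed
  have "U = P \<inter> fst -` (- {0})" "V = P \<inter> snd -` (- {0})"
    by (auto simp: P_def U_def V_def zero_prod_def)
  moreover have "open (fst -` (- {0}) :: ('a \<times> 'a) set)" "open (snd -` (- {0}) :: ('a \<times> 'a) set)"
    by (auto intro!: open_vimage continuous_intros)
  ultimately have op: "openin (top_of_set P) U" "openin (top_of_set P) V"
    by (auto simp: openin_open)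
  have swapP: "continuous_map (top_of_set P) (top_of_set P) prod.swap"
    by (auto simp: P_def zero_prod_def intro!: continuous_on_swap)
  show ?thesis
    unfolding P_def[symmetric]
  proof (rule hom_induced_involution_join[OF op _ swapP])
    show "topspace (top_of_set P) = U \<union> V" using PUV by simp
    show "trivial_group (homology_group p (subtopology (top_of_set P) U))"
      unfolding sub by (rule triv[folded U_def])
    fix n assume "n \<in> carrier (homology_group (p - 1) (subtopology (top_of_set P) (U \<inter> V)))"
    then show "n \<otimes>\<^bsub>homology_group (p - 1) (subtopology (top_of_set P) (U \<inter> V))\<^esub>
        hom_induced (p - 1) (subtopology (top_of_set P) (U \<inter> V)) {}
          (subtopology (top_of_set P) (U \<inter> V)) {} prod.swap n
        = \<one>\<^bsub>homology_group (p - 1) (subtopology (top_of_set P) (U \<inter> V))\<^esub>"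
      unfolding sub by (rule anti[folded NUV])
  next
    show "z \<in> carrier (homology_group p (top_of_set P))"
      using z unfolding P_def .
    show "prod.swap \<in> U \<rightarrow> V" "prod.swap \<in> V \<rightarrow> U"
      by (auto simp: U_def V_def)
  qed simp
qed

section \<open>The swap of the punctured square compared with a reflection of a sphere\<close>

lemma homotopic_reflection_swap:
  fixes W :: "'a::euclidean_space set"
  assumes W: "subspace W"
  shows "homotopic_with_canon (\<lambda>_. True) (W \<times> W - {0}) (W \<times> W - {0}) (\<lambda>z. (fst z, - snd z)) prod.swap"
proof -
  define c where "c t = cos (t * (pi / 2))" for t
  define s where "s t = sin (t * (pi / 2))" for t
  have cs: "c t * c t + s t * s t = 1" for t
    unfolding c_def s_def by (simp flip: power2_eq_square)
  \<comment> \<open>For each t this applies the reflection matrix with rows (c, s) and (s, -c). As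
    the angle goes from 0 to pi/2, it moves from diag(1, -1) to the exchange of the two
    factors.\<close>
  define h where "h p = (c (fst p) *\<^sub>R fst (snd p) + s (fst p) *\<^sub>R snd (snd p),
      s (fst p) *\<^sub>R fst (snd p) - c (fst p) *\<^sub>R snd (snd p))" for p :: "real \<times> 'a \<times> 'a"
  \<comment> \<open>The matrix is its own inverse, so \<open>h\<close> never takes a nonzero pair to
    0.\<close>
  have inverse: "c t *\<^sub>R (c t *\<^sub>R x + s t *\<^sub>R y) + s t *\<^sub>R (s t *\<^sub>R x - c t *\<^sub>R y) = x"
    "s t *\<^sub>R (c t *\<^sub>R x + s t *\<^sub>R y) - c t *\<^sub>R (s t *\<^sub>R x - c t *\<^sub>R y) = y" for t and x y :: 'a
  proof -
    have "c t *\<^sub>R (c t *\<^sub>R x + s t *\<^sub>R y) + s t *\<^sub>R (s t *\<^sub>R x - c t *\<^sub>R y) = (c t * c t + s t * s t) *\<^sub>R x"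
      by (simp add: algebra_simps)
    then show "c t *\<^sub>R (c t *\<^sub>R x + s t *\<^sub>R y) + s t *\<^sub>R (s t *\<^sub>R x - c t *\<^sub>R y) = x" by (simp add: cs)
    have "s t *\<^sub>R (c t *\<^sub>R x + s t *\<^sub>R y) - c t *\<^sub>R (s t *\<^sub>R x - c t *\<^sub>R y) = (c t * c t + s t * s t) *\<^sub>R y"
      by (simp add: algebra_simps)
    then show "s t *\<^sub>R (c t *\<^sub>R x + s t *\<^sub>R y) - c t *\<^sub>R (s t *\<^sub>R x - c t *\<^sub>R y) = y" by (simp add: cs)
  qed
  show ?thesis
  proof (rule homotopic_with_canonI[where h = h])
    show "continuous_on ({0..1} \<times> (W \<times> W - {0})) h"
      unfolding h_def c_def s_def by (intro continuous_intros)
    fix t :: real and z :: "'a \<times> 'a" assume z: "z \<in> W \<times> W - {0}"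
    have "h (t, z) \<in> W \<times> W"
      using z W by (auto simp: h_def subspace_add subspace_diff subspace_scale)
    moreover have "h (t, z) \<noteq> 0"
    proof
      assume "h (t, z) = 0"
      then have eq0: "c t *\<^sub>R fst z + s t *\<^sub>R snd z = 0" "s t *\<^sub>R fst z - c t *\<^sub>R snd z = 0"
        by (simp_all add: h_def zero_prod_def)
      have "fst z = 0" "snd z = 0"
        using inverse[of t "fst z" "snd z"] unfolding eq0 by simp_all
      then show False using z by (simp add: prod_eq_iff zero_prod_def)
    qed
    ultimately show "h (t, z) \<in> W \<times> W - {0}" by simp
  next
    fix z :: "'a \<times> 'a"
    show "h (0, z) = (fst z, - snd z)" "h (1, z) = prod.swap z"
      by (simp_all add: h_def c_def s_def prod_eq_iff)
  qed auto
qed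

lemma nsphere_top_of_set:
  "nsphere p = top_of_set {x. (\<Sum>i\<le>p. (x i)\<^sup>2) = 1 \<and> (\<forall>i>p. x i = 0)}"
  by (simp add: nsphere euclidean_product_topology)

text \<open>The swap deforms to (x, y) \<mapsto> (x, -y). In orthonormal coordinates this changes
  the sign of m + 1 coordinates on a sphere of dimension 2m + 1, so it has degree -1 for even m. A
  trivial action on homology would force degree 1.\<close>

lemma swap_homology_nontrivial:
  fixes W :: "'a::euclidean_space set"
  assumes W: "subspace W" "dim W = m + 1" and m: "even m"
  shows "\<exists>z \<in> carrier (homology_group (int (2 * m + 1)) (top_of_set (W \<times> W - {0}))).
    hom_induced (int (2 * m + 1)) (top_of_set (W \<times> W - {0})) {} (top_of_set (W \<times> W - {0})) {} prod.swap z \<noteq> z"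
proof (rule ccontr)
  define P where "P = W \<times> W - {0}"
  let ?p = "2 * m + 1"
  let ?sw = "hom_induced (int ?p) (top_of_set P) {} (top_of_set P) {} prod.swap"
  assume "\<not> ?thesis"
  then have fixed: "?sw z = z" if "z \<in> carrier (homology_group (int ?p) (top_of_set P))" for z
    using that unfolding P_def by blast
  obtain B where B: "B \<subseteq> W" "pairwise orthogonal B" "\<And>x. x \<in> B \<Longrightarrow> norm x = 1"
      "independent B" "card B = dim W" "span B = W"
    using orthonormal_basis_subspace[OF W(1)] by metis
  have "finite B" using B(4) finiteI_independent by blast
  then obtain b where "bij_betw b {0..<card B} B" using ex_bij_betw_nat_finite by blast
  then have b: "bij_betw b {..m} B" using B(5) W(2) by (simp add: atLeast0LessThan lessThan_Suc_atMost)
  have bW: "b i \<in> W" if "i \<le> m" for i using b that B(1) by (auto simp: bij_betw_def)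
  have on: "b i \<bullet> b j = (if i = j then 1 else 0)" if "i \<le> m" "j \<le> m" for i j
  proof (cases "i = j")
    case True
    have "norm (b j) = 1" using b that B(3) by (auto simp: bij_betw_def)
    then show ?thesis using True by (simp add: dot_square_norm)
  next
    case False
    then have "b i \<noteq> b j" "b i \<in> B" "b j \<in> B" using b that by (auto simp: bij_betw_def inj_on_def)
    then show ?thesis using B(2) False by (auto simp: pairwise_def orthogonal_def)
  qed
  \<comment> \<open>\<psi> puts the first m + 1 coordinates into the first factor and the others
    into the second; \<open>c\<close> reads them back and \<phi> normalises them. So \<phi> is a
    left inverse of \<psi> on the sphere, and \<psi> is injective on homology.\<close>
  define \<psi> where "\<psi> w = (\<Sum>i\<le>m. w i *\<^sub>R b i, \<Sum>i\<le>m. w (m + 1 + i) *\<^sub>R b i)" for w :: "nat \<Rightarrow> real"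
  define c where "c z i = (if i \<le> m then fst z \<bullet> b i else if i \<le> ?p then snd z \<bullet> b (i - (m + 1)) else 0)"
    for z i
  define \<phi> where "\<phi> z i = c z i / sqrt (\<Sum>j\<le>?p. (c z j)\<^sup>2)" for z i
  have coord: "(\<Sum>i\<le>m. a i *\<^sub>R b i) \<bullet> b j = a j" if "j \<le> m" for a :: "nat \<Rightarrow> real" and j
  proof -
    have "(\<Sum>i\<le>m. a i *\<^sub>R b i) \<bullet> b j = (\<Sum>i\<le>m. if i = j then a j else 0)"
      unfolding inner_sum_left using on that by (intro sum.cong) auto
    then show ?thesis using that by simp
  qed
  have c\<psi>: "c (\<psi> w) i = w i" if "\<forall>i>?p. w i = 0" for w i
    using that by (auto simp: c_def \<psi>_def coord)
  have c0: "z = 0" if z: "z \<in> W \<times> W" and cz: "\<forall>i\<le>?p. c z i = 0" for z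
  proof -
    have zero: "x = 0" if "x \<in> W" "\<And>i. i \<le> m \<Longrightarrow> x \<bullet> b i = 0" for x
    proof -
      have "orthogonal x y" if "y \<in> B" for y
        using that b \<open>\<And>i. i \<le> m \<Longrightarrow> x \<bullet> b i = 0\<close> by (auto simp: bij_betw_def orthogonal_def)
      then have "orthogonal x x" using orthogonal_to_span \<open>x \<in> W\<close> B(6) by blast
      then show ?thesis by (simp add: orthogonal_self)
    qed
    have "fst z \<bullet> b i = 0" "snd z \<bullet> b i = 0" if "i \<le> m" for i
      using that cz[rule_format, of i] cz[rule_format, of "m + 1 + i"] by (auto simp: c_def)
    then show ?thesis using zero z by (auto simp: zero_prod_def)
  qed
  let ?S = "{x. (\<Sum>i\<le>?p. (x i)\<^sup>2) = 1 \<and> (\<forall>i>?p. x i = (0::real))}"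
  have \<psi>: "continuous_map (nsphere ?p) (top_of_set P) \<psi>"
  proof -
    have "continuous_on ?S \<psi>"
      unfolding \<psi>_def
      by (intro continuous_intros continuous_on_subset[OF continuous_on_product_coordinates]) auto
    moreover have "\<psi> w \<in> P" if w: "w \<in> ?S" for w
    proof -
      have "\<psi> w \<in> W \<times> W"
        using bW W(1) by (auto simp: \<psi>_def intro!: subspace_sum subspace_scale)
      moreover have "\<psi> w \<noteq> 0"
      proof
        assume "\<psi> w = 0"
        then have "c (\<psi> w) i = 0" for i by (auto simp: c_def)
        then have "w i = 0" for i using c\<psi>[of w] w by auto
        then show False using w by simp
      qed
      ultimately show ?thesis by (simp add: P_def)
    qed
    ultimately show ?thesis by (simp add: nsphere_top_of_set Pi_iff)
  qed
  have \<phi>: "continuous_map (top_of_set P) (nsphere ?p) \<phi>"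
  proof -
    have pos: "0 < (\<Sum>j\<le>?p. (c z j)\<^sup>2)" if "z \<in> P" for z
    proof -
      obtain i where "i \<le> ?p" "c z i \<noteq> 0" using c0[of z] \<open>z \<in> P\<close> unfolding P_def by auto
      then show ?thesis by (intro sum_pos2[of _ i]) auto
    qed
    have cc: "continuous_on P (\<lambda>z. c z i)" for i
      unfolding c_def by (cases "i \<le> m"; cases "i \<le> ?p") (auto intro!: continuous_intros)
    have "continuous_on P (\<lambda>z. \<phi> z i)" for i
      unfolding \<phi>_def using pos by (intro continuous_intros cc) (force simp: less_imp_neq)
    then have "continuous_on P \<phi>" by (rule continuous_on_coordinatewise_then_product)
    moreover have "\<phi> z \<in> ?S" if "z \<in> P" for z
    proof -
      have "(\<Sum>i\<le>?p. (\<phi> z i)\<^sup>2) = (\<Sum>i\<le>?p. (c z i)\<^sup>2) / (\<Sum>j\<le>?p. (c z j)\<^sup>2)"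
        using pos[OF that] unfolding \<phi>_def power_divide sum_divide_distrib[symmetric] by simp
      then have "(\<Sum>i\<le>?p. (\<phi> z i)\<^sup>2) = 1" using pos[OF that] by simp
      moreover have "\<phi> z i = 0" if "i > ?p" for i using that by (auto simp: \<phi>_def c_def)
      ultimately show ?thesis by simp
    qed
    ultimately show ?thesis by (simp add: nsphere_top_of_set Pi_iff)
  qed
  have \<phi>\<psi>: "\<phi> (\<psi> w) = w" if w: "w \<in> topspace (nsphere ?p)" for w
  proof -
    have "c (\<psi> w) = w" using c\<psi>[of w] w by (auto simp: nsphere_top_of_set)
    then show ?thesis using w by (auto simp: \<phi>_def nsphere_top_of_set)
  qed
  \<comment> \<open>These are the m + 1 coordinates of the second factor.\<close>
  define A where "A = {m<..?p}"
  define \<rho> where "\<rho> = (\<lambda>x :: nat \<Rightarrow> real. \<lambda>i. if i \<in> A then - x i else x i)"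
  have \<rho>: "continuous_map (nsphere ?p) (nsphere ?p) \<rho>" "Brouwer_degree2 ?p \<rho> = (-1) ^ card A"
  proof -
    have "finite A" "A \<subseteq> {..?p}" by (auto simp: A_def)
    from Brouwer_degree2_reflections[OF this]
    show "continuous_map (nsphere ?p) (nsphere ?p) \<rho>" "Brouwer_degree2 ?p \<rho> = (-1) ^ card A"
      unfolding \<rho>_def by blast+
  qed
  have deg: "Brouwer_degree2 ?p \<rho> = -1"
    using \<rho>(2) m by (simp add: A_def)
  let ?\<tau> = "\<lambda>z :: 'a \<times> 'a. (fst z, - snd z)"
  have hom: "homotopic_with_canon (\<lambda>_. True) P P ?\<tau> prod.swap"
    unfolding P_def by (rule homotopic_reflection_swap[OF W(1)])
  have \<tau>: "continuous_map (top_of_set P) (top_of_set P) ?\<tau>"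
    using homotopic_with_imp_continuous_maps[OF hom] by blast
  have \<tau>\<psi>: "?\<tau> \<circ> \<psi> = \<psi> \<circ> \<rho>"
  proof
    fix w
    have "(\<Sum>i\<le>m. \<rho> w i *\<^sub>R b i) = (\<Sum>i\<le>m. w i *\<^sub>R b i)"
      by (intro sum.cong) (auto simp: \<rho>_def A_def)
    moreover have "(\<Sum>i\<le>m. \<rho> w (m + 1 + i) *\<^sub>R b i) = (\<Sum>i\<le>m. - (w (m + 1 + i) *\<^sub>R b i))"
      by (intro sum.cong) (auto simp: \<rho>_def A_def)
    ultimately show "(?\<tau> \<circ> \<psi>) w = (\<psi> \<circ> \<rho>) w"
      by (simp add: \<psi>_def sum_negf)
  qed
  let ?N = "nsphere ?p"
  let ?\<psi> = "hom_induced (int ?p) ?N {} (top_of_set P) {} \<psi>"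
  let ?\<phi> = "hom_induced (int ?p) (top_of_set P) {} ?N {} \<phi>"
  let ?\<rho> = "hom_induced (int ?p) ?N {} ?N {} \<rho>"
  have id: "?\<phi> (?\<psi> x) = x" if x: "x \<in> carrier (homology_group (int ?p) ?N)" for x
  proof -
    have "?\<phi> (?\<psi> x) = hom_induced (int ?p) ?N {} ?N {} (\<phi> \<circ> \<psi>) x"
      using hom_induced_compose_empty[OF \<psi> \<phi>, of "int ?p"] by (simp only: comp_apply)
    also have "\<dots> = x"
      using continuous_map_compose[OF \<psi> \<phi>] \<phi>\<psi> x by (intro hom_induced_id_gen) auto
    finally show ?thesis .
  qed
  have "?\<rho> x = x" if x: "x \<in> carrier (homology_group (int ?p) ?N)" for x
  proof -
    have "?\<psi> (?\<rho> x) = hom_induced (int ?p) ?N {} (top_of_set P) {} (?\<tau> \<circ> \<psi>) x"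
      unfolding \<tau>\<psi> using hom_induced_compose_empty[OF \<rho>(1) \<psi>, of "int ?p"] by (simp only: comp_apply)
    also have "\<dots> = hom_induced (int ?p) (top_of_set P) {} (top_of_set P) {} ?\<tau> (?\<psi> x)"
      using hom_induced_compose_empty[OF \<psi> \<tau>, of "int ?p"] by (simp only: comp_apply)
    also have "\<dots> = ?sw (?\<psi> x)"
      using homology_homotopy_empty[OF hom, of "int ?p"] by (simp only:)
    also have "\<dots> = ?\<psi> x"
      by (rule fixed[OF hom_induced_carrier])
    finally show ?thesis using id x hom_induced_carrier by metis
  qed
  \<comment> \<open>Acting on homology as the first power characterises degree 1.\<close>
  then have "Brouwer_degree2 ?p \<rho> = 1"
    using carrier_reduced_homology_group_subset[of "int ?p" ?N] \<rho>(1)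
    by (intro Brouwer_degree2_unique) (auto simp: group.int_pow_1)
  then show False using deg by simp
qed

text \<open>Two planners would make the swap act as -1 in degree 2m on the product of spheres, hence
  as the identity in degree 2m + 1 on the punctured square, against
  \<open>swap_homology_nontrivial\<close>. Positivity of \<open>m\<close> gives 2m > m, so that the
  sphere has no homology in degree 2m.\<close>

lemma even_sphere_no_two_planners:
  fixes W :: "'a::euclidean_space set"
  assumes W: "subspace W" "dim W = m + 1" and m: "even m" "m > 0"
    and U: "openin (top_of_set ((sphere 0 1 \<inter> W) \<times> (sphere 0 1 \<inter> W))) U1"
           "openin (top_of_set ((sphere 0 1 \<inter> W) \<times> (sphere 0 1 \<inter> W))) U2"
    and cover: "(sphere 0 1 \<inter> W) \<times> (sphere 0 1 \<inter> W) = U1 \<union> U2"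
    and hom: "homotopic_with_canon (\<lambda>_. True) U1 (sphere 0 1 \<inter> W) fst snd"
             "homotopic_with_canon (\<lambda>_. True) U2 (sphere 0 1 \<inter> W) fst snd"
  shows False
proof -
  have triv: "trivial_group (homology_group (int q) (top_of_set (sphere 0 1 \<inter> W)))" if "q > m" for q
    using that by (intro trivial_homology_group_subspace_sphere[OF W]) auto
  have q: "int (2 * m + 1) - 1 = int (2 * m)" by simp
  have "hom_induced (int (2 * m + 1)) (top_of_set (W \<times> W - {0})) {} (top_of_set (W \<times> W - {0})) {} prod.swap z = z"
    if "z \<in> carrier (homology_group (int (2 * m + 1)) (top_of_set (W \<times> W - {0})))" for z
    apply (rule hom_induced_swap_punctured_square[OF W(1) _ _ that])
     apply (rule trivial_homology_group_punctured_subspace_times[OF W(1) triv])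
     apply simp
    unfolding q
    apply (rule swap_homology_punctured_subspace[OF W(1)])
     apply (rule swap_homology_two_planners[OF U cover hom triv])
    using m(2) by simp_all
  then show False using swap_homology_nontrivial[OF W m(1)] by blast
qed

section \<open>The exponential law for path spaces, and planners as equivariant homotopies\<close>

section \<open>Path spaces and equivariant homotopies\<close>

lemma path_spaceD:
  assumes "\<gamma> \<in> topspace (path_space (top_of_set S))"
  shows "continuous_on {0..1} \<gamma>" "\<gamma> \<in> {0..1} \<rightarrow> S"
  using assms by (auto simp: path_space_def map_space_def)

text \<open>The unit interval is locally compact: the path \<open>s z\<close> maps a compact
  neighbourhood \<open>K\<close> of t into the given open set, and all paths that do so form an open
  set of the compact-open topology.\<close>

lemma continuous_on_uncurry_path_space:
  fixes s :: "'b::topological_space \<Rightarrow> real \<Rightarrow> 'a::topological_space"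
  assumes s: "continuous_map (top_of_set U) (path_space (top_of_set S)) s"
  shows "continuous_on ({0..1} \<times> U) (\<lambda>(t, z). s z t)"
proof -
  have sP: "s z \<in> topspace (path_space (top_of_set S))" if "z \<in> U" for z
    using continuous_map_image_subset_topspace[OF s] that by auto
  have "\<exists>A. openin (top_of_set ({0..1} \<times> U)) A \<and> p \<in> A \<and> (\<forall>q\<in>A. (case q of (t, z) \<Rightarrow> s z t) \<in> B)"
    if p: "p \<in> {0..1} \<times> U" and B: "open B" "(case p of (t, z) \<Rightarrow> s z t) \<in> B" for p B
  proof -
    obtain t z where [simp]: "p = (t, z)" and tz: "0 \<le> t" "t \<le> 1" "z \<in> U" using p by auto
    have "s z t \<in> B" using B by simp
    then have "\<exists>T. openin (top_of_set {0..1}) T \<and> t \<in> T \<and> s z ` T \<subseteq> B"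
      using path_spaceD(1)[OF sP[OF tz(3)]] continuous_openin_preimage_gen[OF _ B(1), of "{0..1}" "s z"] tz
      by (intro exI[where x = "{0..1} \<inter> s z -` B"]) auto
    then obtain e where e: "e > 0" "s z ` ({0..1} \<inter> cball t e) \<subseteq> B"
      unfolding openin_contains_cball by (auto simp: Int_commute) blast
    define K where "K = {0..1} \<inter> cball t e"
    have K: "compactin (top_of_set {0..1}) K"
      by (auto simp: K_def compactin_subtopology compact_Int)
    define O' where "O' = {f \<in> map_space (top_of_set {0..1}) (top_of_set S). f ` K \<subseteq> B \<inter> S}"
    have "openin (path_space (top_of_set S)) O'"
      unfolding path_space_def compact_open_topology_def O'_def
      using K B(1)
      by (intro topology_generated_by_Basis CollectI exI[of _ K] exI[of _ "B \<inter> S"]) (auto simp: openin_open)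
    then have o: "openin (top_of_set U) {z \<in> U. s z \<in> O'}"
      using openin_continuous_map_preimage[OF s] by simp
    have "s z \<in> O'"
      using e(2) sP[OF tz(3)] path_spaceD(2)[OF sP[OF tz(3)]]
      by (auto simp: O'_def K_def path_space_def)
    moreover have "openin (top_of_set {0..1}) ({0..1} \<inter> ball t e)" by auto
    ultimately show ?thesis
      using o tz e(1)
      by (intro exI[where x = "({0..1} \<inter> ball t e) \<times> {z \<in> U. s z \<in> O'}"])
         (auto intro!: openin_Times simp: O'_def K_def image_subset_iff)
  qed
  then have "\<forall>p \<in> {0..1} \<times> U. \<forall>B. open B \<and> (case p of (t, z) \<Rightarrow> s z t) \<in> B \<longrightarrow>
      (\<exists>A. open A \<and> p \<in> A \<and> (\<forall>q\<in>({0..1} \<times> U). q \<in> A \<longrightarrow> (case q of (t, z) \<Rightarrow> s z t) \<in> B))"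
    unfolding openin_open by (metis (no_types, lifting) IntD2 IntI)
  then show ?thesis unfolding continuous_on_topological by blast
qed

text \<open>By compactness of \<open>K\<close> the projection from K x U to U is closed. So the
  points z for which \<open>h\<close> maps K x {z} into \<open>V\<close> form an open set, as in the
  tube lemma.\<close>

lemma continuous_map_curry_path_space:
  fixes h :: "real \<times> 'b::topological_space \<Rightarrow> 'a::topological_space"
  assumes h: "continuous_on ({0..1} \<times> U) h" and hS: "\<And>t z. \<lbrakk>0 \<le> t; t \<le> 1; z \<in> U\<rbrakk> \<Longrightarrow> h (t, z) \<in> S"
  shows "continuous_map (top_of_set U) (path_space (top_of_set S)) (\<lambda>z. \<lambda>t\<in>{0..1}. h (t, z))"
  unfolding path_space_def compact_open_topology_def
proof (rule continuous_on_generated_topo)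
  let ?s = "\<lambda>z. \<lambda>t\<in>{0..1}. h (t, z)"
  let ?M = "map_space (top_of_set {0..1::real}) (top_of_set S)"
  let ?B = "{{f \<in> ?M. f ` K \<subseteq> V} |K V. compactin (top_of_set {0..1::real}) K \<and> openin (top_of_set S) V}"
  have M: "?s z \<in> ?M" if "z \<in> U" for z
  proof -
    have "continuous_on {0..1} (h \<circ> (\<lambda>t. (t, z)))"
      using that by (intro continuous_on_compose continuous_intros continuous_on_subset[OF h]) auto
    then have "continuous_on {0..1} (?s z)"
      by (rule continuous_on_eq) auto
    then show ?thesis using hS that by (auto simp: map_space_def)
  qed
  show "?s ` topspace (top_of_set U) \<subseteq> \<Union> ?B"
  proof -
    have "?M \<in> ?B"
      using compactin_empty openin_topspace by (intro CollectI exI[of _ "{}"] exI[of _ S]) auto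
    then show ?thesis using M by auto
  qed
  fix W assume "W \<in> ?B"
  then obtain K V where W: "W = {f \<in> ?M. f ` K \<subseteq> V}" and K: "compactin (top_of_set {0..1::real}) K"
    and V: "openin (top_of_set S) V" by blast
  obtain V' where V': "open V'" "V = S \<inter> V'" using V by (auto simp: openin_open)
  have K01: "compact K" "K \<subseteq> {0..1}" using K by (auto simp: compactin_subtopology)
  define C where "C = (K \<times> U) \<inter> h -` (- V')"
  have "closedin (top_of_set (K \<times> U)) C"
    unfolding C_def using V'(1) K01
    by (intro continuous_closedin_preimage continuous_on_subset[OF h]) auto
  then have "closedin (prod_topology (top_of_set K) (top_of_set U)) C" by simp
  moreover have "closed_map (prod_topology (top_of_set K) (top_of_set U)) (top_of_set U) snd"
    using K01(1) by (intro closed_map_snd) (simp add: compact_space_subtopology)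
  ultimately have "closedin (top_of_set U) (snd ` C)" by (auto simp: closed_map_def)
  then have "openin (top_of_set U) (U - snd ` C)" by auto
  moreover have "?s -` W \<inter> topspace (top_of_set U) = U - snd ` C"
  proof -
    have "(\<forall>t\<in>K. h (t, z) \<in> V) \<longleftrightarrow> z \<notin> snd ` C" if "z \<in> U" for z
      using that hS K01(2) by (force simp: C_def V'(2) image_iff)
    moreover have "?s z ` K \<subseteq> V \<longleftrightarrow> (\<forall>t\<in>K. h (t, z) \<in> V)" for z
      using K01(2) by (auto simp: image_subset_iff subset_iff)
    ultimately show ?thesis using M by (auto simp: W)
  qed
  ultimately show "openin (top_of_set U) (?s -` W \<inter> topspace (top_of_set U))" by simp
qed

text \<open>Uncurrying a planner gives the homotopy. Over a pair of fixed points equivariance makes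
  the whole path fixed, so the same homotopy stays inside \<open>F\<close>.\<close>

lemma equivariant_motion_planner_homotopic:
  fixes S :: "'a::topological_space set"
  assumes s: "equivariant_motion_planner G (top_of_set S) \<phi> U s" and US: "U \<subseteq> S \<times> S"
    and F: "F = fixed_point_set G S \<phi>"
  shows "homotopic_with_canon (\<lambda>_. True) U S fst snd"
    and "homotopic_with_canon (\<lambda>_. True) (U \<inter> F \<times> F) F fst snd"
proof -
  have sc: "continuous_map (top_of_set U) (path_space (top_of_set S)) s"
    using s US by (simp add: equivariant_motion_planner_def subtopology_subtopology Int_absorb1)
  have eq: "s (diagonal_action \<phi> g z) = path_action \<phi> g (s z)" if "g \<in> carrier G" "z \<in> U" for g z
    using s that by (auto simp: equivariant_motion_planner_def equivariant_on_def)
  have ends: "s z 0 = fst z" "s z 1 = snd z" if "z \<in> U" for z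
    using s that by (auto simp: equivariant_motion_planner_def path_ends_def prod_eq_iff)
  have cont: "continuous_on ({0..1} \<times> U) (\<lambda>(t, z). s z t)"
    by (rule continuous_on_uncurry_path_space[OF sc])
  have sS: "s z t \<in> S" if "z \<in> U" "0 \<le> t" "t \<le> 1" for z t
    using that path_spaceD(2)[of "s z" S] continuous_map_image_subset_topspace[OF sc]
    by (auto simp: image_subset_iff Pi_iff)
  show "homotopic_with_canon (\<lambda>_. True) U S fst snd"
    using cont sS ends by (intro homotopic_with_canonI[where h = "\<lambda>(t, z). s z t"]) auto
  show "homotopic_with_canon (\<lambda>_. True) (U \<inter> F \<times> F) F fst snd"
  proof (rule homotopic_with_canonI[where h = "\<lambda>(t, z). s z t"])
    show "continuous_on ({0..1} \<times> (U \<inter> F \<times> F)) (\<lambda>(t, z). s z t)"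
      by (rule continuous_on_subset[OF cont]) auto
    fix t :: real and z assume t: "0 \<le> t" "t \<le> 1" and z: "z \<in> U \<inter> F \<times> F"
    have "\<phi> g (s z t) = s z t" if g: "g \<in> carrier G" for g
    proof -
      have "diagonal_action \<phi> g z = z"
        using z g by (auto simp: diagonal_action_def F fixed_point_set_def prod_eq_iff)
      then have "s z = path_action \<phi> g (s z)" using eq[OF g, of z] z by simp
      then have "s z t = path_action \<phi> g (s z) t" by simp
      then show ?thesis using t by (simp add: path_action_def)
    qed
    then show "(case (t, z) of (t, z) \<Rightarrow> s z t) \<in> F"
      using sS[of z t] z t by (auto simp: F fixed_point_set_def)
  qed (use ends in auto)
qed

lemma equivariant_motion_planner_of_homotopic:
  fixes S :: "'a::topological_space set"
  assumes hom: "homotopic_with_canon (equivariant_on G (diagonal_action \<phi>) \<phi> U) U S fst snd"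
    and inv: "invariant_set G (diagonal_action \<phi>) U" and US: "U \<subseteq> S \<times> S"
  shows "\<exists>s. equivariant_motion_planner G (top_of_set S) \<phi> U s"
proof -
  obtain h where h: "continuous_on ({0..1::real} \<times> U) h" "h \<in> {0..1} \<times> U \<rightarrow> S"
    and h0: "\<And>z. h (0, z) = fst z" and h1: "\<And>z. h (1, z) = snd z"
    and eq: "\<And>t. t \<in> {0..1} \<Longrightarrow> equivariant_on G (diagonal_action \<phi>) \<phi> U (\<lambda>z. h (t, z))"
    using homotopic_with_canonD[OF hom] by blast
  \<comment> \<open>The restriction to the unit interval makes each path extensional, as membership
    in \<open>map_space\<close> demands.\<close>
  have "continuous_map (top_of_set U) (path_space (top_of_set S)) (\<lambda>z. \<lambda>t\<in>{0..1}. h (t, z))"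
    using h by (intro continuous_map_curry_path_space) auto
  moreover have "equivariant_on G (diagonal_action \<phi>) (path_action \<phi>) U (\<lambda>z. \<lambda>t\<in>{0..1}. h (t, z))"
    using eq by (force simp: equivariant_on_def path_action_def fun_eq_iff)
  moreover have "path_ends (\<lambda>t\<in>{0..1}. h (t, z)) = z" for z
    by (simp add: path_ends_def h0 h1)
  ultimately show ?thesis
    using US by (auto simp: equivariant_motion_planner_def subtopology_subtopology Int_absorb1)
qed

lemma equivariant_TC_eqI:
  assumes "has_equivariant_planner_cover G X \<phi> m" "m \<ge> 1"
    and "\<And>j. \<lbrakk>1 \<le> j; j < m\<rbrakk> \<Longrightarrow> \<not> has_equivariant_planner_cover G X \<phi> j"
  shows "equivariant_TC G X \<phi> = enat m"
  unfolding equivariant_TC_def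
proof (rule antisym)
  show "Inf {enat m |m. 1 \<le> m \<and> has_equivariant_planner_cover G X \<phi> m} \<le> enat m"
    using assms by (intro Inf_lower) auto
  show "enat m \<le> Inf {enat m |m. 1 \<le> m \<and> has_equivariant_planner_cover G X \<phi> m}"
    using assms(3) by (intro Inf_greatest) (auto simp: not_less[symmetric])
qed

text \<open>Unit vectors that are not antipodal are joined by the normalised straight segment.
  Orthogonal maps are linear and preserve norms, so this construction commutes with the
  action.\<close>

lemma geodesic_equivariant_homotopic:
  fixes a b :: "'b::topological_space \<Rightarrow> 'v::euclidean_space"
  assumes cont: "continuous_on U a" "continuous_on U b"
    and sph: "a \<in> U \<rightarrow> sphere 0 1" "b \<in> U \<rightarrow> sphere 0 1"
    and eqv: "equivariant_on G \<psi> (sphere_action \<rho>) U a" "equivariant_on G \<psi> (sphere_action \<rho>) U b"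
    and ne: "\<And>z. z \<in> U \<Longrightarrow> a z \<noteq> - b z"
    and orth: "\<And>g. g \<in> carrier G \<Longrightarrow> orthogonal_transformation (\<rho> g)"
    and inv: "invariant_set G \<psi> U"
  shows "homotopic_with_canon (equivariant_on G \<psi> (sphere_action \<rho>) U) U (sphere 0 1) a b"
proof -
  define l where "l p = (1 - fst p) *\<^sub>R a (snd p) + fst p *\<^sub>R b (snd p)" for p :: "real \<times> 'b"
  define h where "h p = l p /\<^sub>R norm (l p)" for p
  have na: "norm (a z) = 1" and nb: "norm (b z) = 1" if "z \<in> U" for z
    using sph that by (auto simp: Pi_iff)
  \<comment> \<open>If the segment met 0, comparing norms would give t = 1 - t and then a z = - b
    z.\<close>
  have l0: "l (t, z) \<noteq> 0" if "0 \<le> t" "t \<le> 1" "z \<in> U" for t z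
  proof
    assume "l (t, z) = 0"
    then have e: "(1 - t) *\<^sub>R a z = - (t *\<^sub>R b z)" by (simp add: l_def eq_neg_iff_add_eq_0)
    then have "norm ((1 - t) *\<^sub>R a z) = norm (t *\<^sub>R b z)" by simp
    then have t: "1 - t = t" using that na nb by simp
    have "t *\<^sub>R a z = t *\<^sub>R (- b z)" using e unfolding t by simp
    moreover have "t \<noteq> 0" using t by auto
    ultimately have "a z = - b z" by (simp only: scaleR_cancel_left) simp
    then show False using ne that by simp
  qed
  have ll: "l (t, \<psi> g z) = \<rho> g (l (t, z))" if "g \<in> carrier G" "z \<in> U" for g t z
  proof -
    have "a (\<psi> g z) = \<rho> g (a z)" "b (\<psi> g z) = \<rho> g (b z)"
      using eqv sph that by (auto simp: equivariant_on_def sphere_action_def Pi_iff)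
    then show ?thesis
      using orthogonal_transformation_linear[OF orth[OF that(1)]]
      by (simp add: l_def linear_add linear_scale)
  qed
  show ?thesis
  proof (rule homotopic_with_canonI[where h = h])
    \<comment> \<open>Since \<open>U\<close> is invariant, equivariance on \<open>U\<close> involves
      only values on \<open>U\<close>.\<close>
    show "equivariant_on G \<psi> (sphere_action \<rho>) U h \<longleftrightarrow> equivariant_on G \<psi> (sphere_action \<rho>) U k"
      if "\<And>x. x \<in> U \<Longrightarrow> h x = k x" for h k
      using that inv by (auto simp: equivariant_on_def invariant_set_def)
    have "continuous_on ({0..1} \<times> U) l"
      unfolding l_def
      by (intro continuous_intros continuous_on_compose2[OF cont(1)] continuous_on_compose2[OF cont(2)]) auto
    then show "continuous_on ({0..1} \<times> U) h"
      unfolding h_def using l0 by (intro continuous_intros) auto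
    show "h (t, z) \<in> sphere 0 1" if "0 \<le> t" "t \<le> 1" "z \<in> U" for t z
      using l0[OF that] by (simp add: h_def)
    show "h (0, z) = a z" "h (1, z) = b z" if "z \<in> U" for z
      using na nb that by (simp_all add: h_def l_def)
    show "equivariant_on G \<psi> (sphere_action \<rho>) U (\<lambda>z. h (t, z))" if t: "0 \<le> t" "t \<le> 1" for t
      unfolding equivariant_on_def
    proof (intro ballI)
      fix g z assume g: "g \<in> carrier G" and z: "z \<in> U"
      have "h (t, \<psi> g z) = \<rho> g (h (t, z))"
        using orth[OF g] by (simp add: h_def ll[OF g z] orthogonal_transformation linear_scale)
      moreover have "h (t, z) \<in> sphere 0 1" using l0[OF t z] by (simp add: h_def)
      ultimately show "h (t, \<psi> g z) = sphere_action \<rho> g (h (t, z))" by (simp add: sphere_action_def)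
    qed
  qed
qed

section \<open>Planner domains and lower bounds for the number of planners\<close>

section \<open>Planners on linear spheres\<close>

definition planner_domain ::
  "('g, 'c) monoid_scheme \<Rightarrow> 'a topology \<Rightarrow> ('g \<Rightarrow> 'a \<Rightarrow> 'a) \<Rightarrow> ('a \<times> 'a) set \<Rightarrow> bool" where
  "planner_domain G X \<phi> U \<longleftrightarrow> openin (prod_topology X X) U \<and>
     invariant_set G (diagonal_action \<phi>) U \<and> (\<exists>s. equivariant_motion_planner G X \<phi> U s)"

lemma has_equivariant_planner_cover_2:
  "has_equivariant_planner_cover G X \<phi> 2 \<longleftrightarrow>
    (\<exists>U V. planner_domain G X \<phi> U \<and> planner_domain G X \<phi> V \<and> U \<union> V = topspace (prod_topology X X))"
    (is "_ = ?R")
proof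
  have 2: "{1..2} = {1, 2 :: nat}" by auto
  show ?R if c: "has_equivariant_planner_cover G X \<phi> 2"
  proof -
    obtain U :: "nat \<Rightarrow> _" where "(\<Union>i\<in>{1..2}. U i) = topspace (prod_topology X X)"
      and "\<forall>i\<in>{1..2}. planner_domain G X \<phi> (U i)"
      using c unfolding has_equivariant_planner_cover_def planner_domain_def by blast
    then show ?thesis unfolding 2 by (intro exI[of _ "U 1"] exI[of _ "U 2"]) auto
  qed
  assume ?R
  then obtain U V where "planner_domain G X \<phi> U" "planner_domain G X \<phi> V"
    "U \<union> V = topspace (prod_topology X X)" by blast
  then show "has_equivariant_planner_cover G X \<phi> 2"
    unfolding has_equivariant_planner_cover_def planner_domain_def 2
    by (intro exI[of _ "\<lambda>i. if i = 1 then U else V"]) auto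
qed

lemma has_equivariant_planner_cover_1:
  "has_equivariant_planner_cover G X \<phi> 1 \<longleftrightarrow> planner_domain G X \<phi> (topspace (prod_topology X X))"
proof -
  have 1: "{1..1} = {1 :: nat}" by auto
  show ?thesis
    unfolding has_equivariant_planner_cover_def planner_domain_def 1
    by (auto intro: exI[of _ "\<lambda>_. topspace (prod_topology X X)"])
qed

lemma has_equivariant_planner_cover_3I:
  assumes "planner_domain G X \<phi> U" "planner_domain G X \<phi> V" "planner_domain G X \<phi> W"
    "U \<union> V \<union> W = topspace (prod_topology X X)"
  shows "has_equivariant_planner_cover G X \<phi> 3"
proof -
  have 3: "{1..3} = {1, 2, 3 :: nat}" by auto
  show ?thesis
    using assms unfolding has_equivariant_planner_cover_def planner_domain_def 3
    by (intro exI[of _ "\<lambda>i. if i = 1 then U else if i = 2 then V else W"]) auto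
qed

lemma planner_domain_sphereI:
  fixes \<rho> :: "'g \<Rightarrow> 'v::euclidean_space \<Rightarrow> 'v"
  assumes "openin (top_of_set (sphere 0 1 \<times> sphere 0 1)) U"
    and "invariant_set G (diagonal_action (sphere_action \<rho>)) U"
    and "homotopic_with_canon (equivariant_on G (diagonal_action (sphere_action \<rho>)) (sphere_action \<rho>) U)
           U (sphere 0 1) fst snd"
  shows "planner_domain G (top_of_set (sphere 0 1)) (sphere_action \<rho>) U"
  using assms openin_imp_subset[OF assms(1)] equivariant_motion_planner_of_homotopic[OF assms(3,2)]
  by (simp add: planner_domain_def)

text \<open>Fixing the second point at \<open>e\<close> turns the two projections into the identity
  and a constant map.\<close>

lemma contractible_of_global_planner:
  fixes S :: "'v::euclidean_space set"
  assumes hom: "homotopic_with_canon (\<lambda>_. True) (S \<times> S) S fst snd" and e: "e \<in> S"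
  shows "contractible S"
proof -
  have "homotopic_with_canon (\<lambda>_. True) S S (fst \<circ> (\<lambda>x. (x, e))) (snd \<circ> (\<lambda>x. (x, e)))"
    by (rule homotopic_with_compose_continuous_map_right[OF hom]) (use e in \<open>auto intro!: continuous_intros\<close>)
  then show ?thesis by (auto simp: contractible_def o_def id_def)
qed

lemma no_equivariant_planner_cover_1:
  fixes \<rho> :: "'g \<Rightarrow> 'v::euclidean_space \<Rightarrow> 'v"
  shows "\<not> has_equivariant_planner_cover G (top_of_set (sphere 0 1)) (sphere_action \<rho>) 1"
proof
  let ?S = "sphere 0 1 :: 'v set"
  assume "has_equivariant_planner_cover G (top_of_set ?S) (sphere_action \<rho>) 1"
  then obtain s where "equivariant_motion_planner G (top_of_set ?S) (sphere_action \<rho>) (?S \<times> ?S) s"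
    unfolding has_equivariant_planner_cover_1 planner_domain_def by auto
  then have "homotopic_with_canon (\<lambda>_. True) (?S \<times> ?S) ?S fst snd"
    using equivariant_motion_planner_homotopic(1) by blast
  moreover obtain e :: 'v where "norm e = 1" using vector_choose_size[of 1] by auto
  ultimately have "contractible ?S" by (intro contractible_of_global_planner) auto
  then show False by (simp add: contractible_sphere)
qed

text \<open>Planners restrict to X x X, where X is the whole sphere or the fixed sphere; in the
  second case equivariance keeps the paths in X. The subspace \<open>W\<close> is left open so that
  one statement serves both parity cases.\<close>

lemma no_equivariant_planner_cover_2:
  fixes \<rho> :: "'g \<Rightarrow> 'v::euclidean_space \<Rightarrow> 'v"
  assumes W: "subspace W" "dim W = m + 1" "even m" "m > 0"
    and F: "sphere 0 1 \<inter> W = sphere 0 1 \<or> sphere 0 1 \<inter> W = fixed_point_set G (sphere 0 1) (sphere_action \<rho>)"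
  shows "\<not> has_equivariant_planner_cover G (top_of_set (sphere 0 1)) (sphere_action \<rho>) 2"
proof
  let ?S = "sphere 0 1 :: 'v set" and ?X = "sphere 0 1 \<inter> W"
  assume "has_equivariant_planner_cover G (top_of_set ?S) (sphere_action \<rho>) 2"
  then obtain U V where U: "planner_domain G (top_of_set ?S) (sphere_action \<rho>) U"
    and V: "planner_domain G (top_of_set ?S) (sphere_action \<rho>) V" and UV: "U \<union> V = ?S \<times> ?S"
    unfolding has_equivariant_planner_cover_2 by auto
  have "openin (top_of_set (?X \<times> ?X)) (A \<inter> ?X \<times> ?X) \<and> homotopic_with_canon (\<lambda>_. True) (A \<inter> ?X \<times> ?X) ?X fst snd"
    if A: "planner_domain G (top_of_set ?S) (sphere_action \<rho>) A" for A
  proof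
    have o: "openin (top_of_set (?S \<times> ?S)) A" using A by (simp add: planner_domain_def)
    then obtain T where T: "open T" "A = (?S \<times> ?S) \<inter> T" unfolding openin_open by blast
    then have "A \<inter> ?X \<times> ?X = (?X \<times> ?X) \<inter> T" by blast
    then show "openin (top_of_set (?X \<times> ?X)) (A \<inter> ?X \<times> ?X)"
      unfolding openin_open using T(1) by blast
    have AS: "A \<subseteq> ?S \<times> ?S" using o openin_imp_subset by blast
    obtain s where s: "equivariant_motion_planner G (top_of_set ?S) (sphere_action \<rho>) A s"
      using A by (auto simp: planner_domain_def)
    show "homotopic_with_canon (\<lambda>_. True) (A \<inter> ?X \<times> ?X) ?X fst snd"
      using F
    proof
      assume X: "?X = ?S"
      have "A \<inter> ?S \<times> ?S = A" using AS by blast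
      then show ?thesis unfolding X using equivariant_motion_planner_homotopic(1)[OF s AS refl] by simp
    next
      assume X: "?X = fixed_point_set G ?S (sphere_action \<rho>)"
      show ?thesis by (rule equivariant_motion_planner_homotopic(2)[OF s AS X])
    qed
  qed
  note U' = this[OF U] and V' = this[OF V]
  have "?X \<times> ?X = U \<inter> ?X \<times> ?X \<union> V \<inter> ?X \<times> ?X"
    using UV by blast
  then show False
    by (rule even_sphere_no_two_planners[OF W conjunct1[OF U'] conjunct1[OF V'] _
          conjunct2[OF U'] conjunct2[OF V']])
qed

lemma openin_neq:
  fixes f g :: "'a::topological_space \<Rightarrow> 'b::real_normed_vector"
  assumes "continuous_on S f" "continuous_on S g"
  shows "openin (top_of_set S) {z \<in> S. f z \<noteq> g z}"
proof -
  have "{z \<in> S. f z \<noteq> g z} = S \<inter> (\<lambda>z. f z - g z) -` (- {0})" by auto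
  then show ?thesis
    using continuous_openin_preimage_gen[of S "\<lambda>z. f z - g z" "- {0}"] assms
    by (simp add: continuous_on_diff open_Compl)
qed

lemma unit_vector_neq_uminus:
  fixes y :: "'a::real_normed_vector"
  assumes "norm y = 1"
  shows "y \<noteq> - y"
proof
  assume "y = - y"
  then have "2 *\<^sub>R y = 0" by (simp add: scaleR_2 eq_neg_iff_add_eq_0)
  then show False using assms by simp
qed

section \<open>Explicit planners on a linear sphere\<close>

locale linear_sphere =
  fixes G :: "('g, 'c) monoid_scheme" and \<rho> :: "'g \<Rightarrow> 'v::euclidean_space \<Rightarrow> 'v"
  assumes rep: "orthogonal_representation G \<rho>"
begin

abbreviation "\<phi> \<equiv> sphere_action \<rho>"

lemma orth: "g \<in> carrier G \<Longrightarrow> orthogonal_transformation (\<rho> g)"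
  using rep by (simp add: orthogonal_representation_def)

lemma lin: "g \<in> carrier G \<Longrightarrow> linear (\<rho> g)"
  using orth by (simp add: orthogonal_transformation_linear)

lemma norm_action [simp]: "g \<in> carrier G \<Longrightarrow> norm (\<rho> g x) = norm x"
  using orth by (simp add: orthogonal_transformation)

lemma inner_action [simp]: "g \<in> carrier G \<Longrightarrow> \<rho> g x \<bullet> \<rho> g y = x \<bullet> y"
  using orth by (simp add: orthogonal_transformation_def)

lemma inj_action: "g \<in> carrier G \<Longrightarrow> \<rho> g x = \<rho> g y \<longleftrightarrow> x = y"
  using orth orthogonal_transformation_inj by (metis injD)

lemma diagonal_sphere_action: "\<lbrakk>norm (fst z) = 1; norm (snd z) = 1\<rbrakk> \<Longrightarrow> diagonal_action \<phi> g z = (\<rho> g (fst z), \<rho> g (snd z))"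
  by (simp add: diagonal_action_def sphere_action_def)

lemma equivariant_fst: "U \<subseteq> sphere 0 1 \<times> sphere 0 1 \<Longrightarrow> equivariant_on G (diagonal_action \<phi>) \<phi> U fst"
  and equivariant_snd: "U \<subseteq> sphere 0 1 \<times> sphere 0 1 \<Longrightarrow> equivariant_on G (diagonal_action \<phi>) \<phi> U snd"
  by (auto simp: equivariant_on_def diagonal_action_def)

lemma planner_domain_nonantipodal:
  "planner_domain G (top_of_set (sphere 0 1)) \<phi> {z \<in> sphere 0 1 \<times> sphere 0 1. fst z \<noteq> - snd z}"
    (is "planner_domain _ _ _ ?U")
proof (rule planner_domain_sphereI)
  show "openin (top_of_set (sphere 0 1 \<times> sphere 0 1)) ?U"
    by (intro openin_neq continuous_intros)
  show inv: "invariant_set G (diagonal_action \<phi>) ?U"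
    unfolding invariant_set_def
  proof (intro ballI)
    fix g z assume g: "g \<in> carrier G" and z: "z \<in> ?U"
    then have "\<rho> g (fst z) \<noteq> - \<rho> g (snd z)"
      using inj_action[OF g, of "fst z" "- snd z"] linear_neg[OF lin[OF g]] by simp
    then show "diagonal_action \<phi> g z \<in> ?U" using g z by (simp add: diagonal_sphere_action mem_Times_iff)
  qed
  show "homotopic_with_canon (equivariant_on G (diagonal_action \<phi>) \<phi> ?U) ?U (sphere 0 1) fst snd"
    by (rule geodesic_equivariant_homotopic[where \<psi> = "diagonal_action \<phi>"])
       (use inv orth in \<open>auto intro!: continuous_intros equivariant_fst equivariant_snd\<close>)
qed

text \<open>The constant map at a fixed vector is equivariant, so one may move along geodesics from
  x to \<open>e\<close> and then from \<open>e\<close> to y.\<close>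

lemma planner_domain_fixed:
  assumes e: "norm e = 1" "\<And>g. g \<in> carrier G \<Longrightarrow> \<rho> g e = e"
  shows "planner_domain G (top_of_set (sphere 0 1)) \<phi>
    {z \<in> sphere 0 1 \<times> sphere 0 1. fst z \<noteq> - e \<and> snd z \<noteq> - e}" (is "planner_domain _ _ _ ?U")
proof (rule planner_domain_sphereI)
  have "?U = {z \<in> sphere 0 1 \<times> sphere 0 1. fst z \<noteq> - e} \<inter> {z \<in> sphere 0 1 \<times> sphere 0 1. snd z \<noteq> - e}" by auto
  then show "openin (top_of_set (sphere 0 1 \<times> sphere 0 1)) ?U"
    by (simp only:) (intro openin_Int openin_neq continuous_intros)
  show inv: "invariant_set G (diagonal_action \<phi>) ?U"
    unfolding invariant_set_def
  proof (intro ballI)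
    fix g z assume g: "g \<in> carrier G" and z: "z \<in> ?U"
    have "\<rho> g (- e) = - e" using linear_neg[OF lin[OF g], of e] e(2)[OF g] by simp
    then have "\<rho> g (fst z) \<noteq> - e" "\<rho> g (snd z) \<noteq> - e"
      using inj_action[OF g, of "fst z" "- e"] inj_action[OF g, of "snd z" "- e"] z by simp_all
    then show "diagonal_action \<phi> g z \<in> ?U" using g z by (simp add: diagonal_sphere_action mem_Times_iff)
  qed
  have eqe: "equivariant_on G (diagonal_action \<phi>) \<phi> ?U (\<lambda>_. e)"
    using e by (simp add: equivariant_on_def sphere_action_def)
  have "homotopic_with_canon (equivariant_on G (diagonal_action \<phi>) \<phi> ?U) ?U (sphere 0 1) fst (\<lambda>_. e)"
    by (rule geodesic_equivariant_homotopic[where \<psi> = "diagonal_action \<phi>", OF _ _ _ _ equivariant_fst eqe _ orth inv])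
       (use e in \<open>auto intro!: continuous_intros\<close>)
  moreover have "homotopic_with_canon (equivariant_on G (diagonal_action \<phi>) \<phi> ?U) ?U (sphere 0 1) (\<lambda>_. e) snd"
    by (rule geodesic_equivariant_homotopic[where \<psi> = "diagonal_action \<phi>", OF _ _ _ _ eqe equivariant_snd _ orth inv])
       (use e in \<open>auto intro!: continuous_intros simp: equation_minus_iff\<close>)
  ultimately show "homotopic_with_canon (equivariant_on G (diagonal_action \<phi>) \<phi> ?U) ?U (sphere 0 1) fst snd"
    by (rule homotopic_with_trans)
qed

text \<open>The route leads from x to -y, then to the normalised field at y, then to y. The first
  leg exists because x is not y, the other two because the field is orthogonal to y.\<close>

lemma planner_domain_tangent_field:
  assumes v: "continuous_on (sphere 0 1) v"
    and tangent: "\<And>y. y \<in> sphere 0 1 \<Longrightarrow> y \<bullet> v y = 0"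
    and equiv: "\<And>g y. \<lbrakk>g \<in> carrier G; y \<in> sphere 0 1\<rbrakk> \<Longrightarrow> v (\<rho> g y) = \<rho> g (v y)"
  shows "planner_domain G (top_of_set (sphere 0 1)) \<phi>
    {z \<in> sphere 0 1 \<times> sphere 0 1. fst z \<noteq> snd z \<and> v (snd z) \<noteq> 0}" (is "planner_domain _ _ _ ?U")
proof (rule planner_domain_sphereI)
  have vs: "continuous_on (sphere 0 1 \<times> sphere 0 1) (\<lambda>z. v (snd z))"
    by (intro continuous_on_compose2[OF v] continuous_intros) auto
  have "?U = {z \<in> sphere 0 1 \<times> sphere 0 1. fst z \<noteq> snd z} \<inter> {z \<in> sphere 0 1 \<times> sphere 0 1. v (snd z) \<noteq> 0}" by auto
  then show "openin (top_of_set (sphere 0 1 \<times> sphere 0 1)) ?U"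
    by (simp only:) (intro openin_Int openin_neq vs continuous_intros)
  show inv: "invariant_set G (diagonal_action \<phi>) ?U"
    unfolding invariant_set_def
  proof (intro ballI)
    fix g z assume g: "g \<in> carrier G" and z: "z \<in> ?U"
    have "\<rho> g (fst z) \<noteq> \<rho> g (snd z)" using inj_action[OF g] z by auto
    moreover have "v (\<rho> g (snd z)) \<noteq> 0"
      using equiv[OF g, of "snd z"] norm_action[OF g, of "v (snd z)"] z by auto
    ultimately show "diagonal_action \<phi> g z \<in> ?U" using g z by (simp add: diagonal_sphere_action mem_Times_iff)
  qed
  define w where "w z = v (snd z) /\<^sub>R norm (v (snd z))" for z :: "'v \<times> 'v"
  have cw: "continuous_on ?U w"
    unfolding w_def by (intro continuous_intros continuous_on_subset[OF vs]) auto
  have sw: "w \<in> ?U \<rightarrow> sphere 0 1" by (auto simp: w_def)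
  have eqm: "equivariant_on G (diagonal_action \<phi>) \<phi> ?U (\<lambda>z. - snd z)"
    unfolding equivariant_on_def
  proof (intro ballI)
    fix g z assume g: "g \<in> carrier G" and "z \<in> ?U"
    then show "- snd (diagonal_action \<phi> g z) = \<phi> g (- snd z)"
      using linear_neg[OF lin[OF g]] by (auto simp: diagonal_sphere_action sphere_action_def)
  qed
  have eqw: "equivariant_on G (diagonal_action \<phi>) \<phi> ?U w"
    unfolding equivariant_on_def
  proof (intro ballI)
    fix g z assume g: "g \<in> carrier G" and z: "z \<in> ?U"
    have "w z \<in> sphere 0 1" using sw z by blast
    then have "\<phi> g (w z) = \<rho> g (w z)" by (simp add: sphere_action_def)
    moreover have "w (diagonal_action \<phi> g z) = \<rho> g (w z)"
      using z g equiv[OF g, of "snd z"] linear_scale[OF lin[OF g]] by (auto simp: diagonal_sphere_action w_def)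
    ultimately show "w (diagonal_action \<phi> g z) = \<phi> g (w z)" by simp
  qed
  have perp: "snd z \<bullet> w z = 0" if "z \<in> ?U" for z
    using tangent that by (auto simp: w_def)
  have ns: "norm (snd z) = 1" if "z \<in> ?U" for z using that by auto
  have "homotopic_with_canon (equivariant_on G (diagonal_action \<phi>) \<phi> ?U) ?U (sphere 0 1) fst (\<lambda>z. - snd z)"
    by (rule geodesic_equivariant_homotopic[where \<psi> = "diagonal_action \<phi>", OF _ _ _ _ equivariant_fst eqm _ orth inv])
       (auto intro!: continuous_intros)
  moreover have "homotopic_with_canon (equivariant_on G (diagonal_action \<phi>) \<phi> ?U) ?U (sphere 0 1) (\<lambda>z. - snd z) w"
  proof (rule geodesic_equivariant_homotopic[where \<psi> = "diagonal_action \<phi>", OF _ cw _ sw eqm eqw _ orth inv])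
    show "- snd z \<noteq> - w z" if "z \<in> ?U" for z
      using perp[OF that] ns[OF that] by (auto simp: dot_square_norm)
  qed (auto intro!: continuous_intros)
  moreover have "homotopic_with_canon (equivariant_on G (diagonal_action \<phi>) \<phi> ?U) ?U (sphere 0 1) w snd"
  proof (rule geodesic_equivariant_homotopic[where \<psi> = "diagonal_action \<phi>", OF cw _ sw _ eqw equivariant_snd _ orth inv])
    show "w z \<noteq> - snd z" if "z \<in> ?U" for z
      using perp[OF that] ns[OF that] by (auto simp: dot_square_norm)
  qed (auto intro!: continuous_intros)
  ultimately show "homotopic_with_canon (equivariant_on G (diagonal_action \<phi>) \<phi> ?U) ?U (sphere 0 1) fst snd"
    using homotopic_with_trans by blast
qed

lemma has_planner_cover_2:
  assumes "continuous_on (sphere 0 1) v"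
    and "\<And>y. y \<in> sphere 0 1 \<Longrightarrow> y \<bullet> v y = 0"
    and "\<And>g y. \<lbrakk>g \<in> carrier G; y \<in> sphere 0 1\<rbrakk> \<Longrightarrow> v (\<rho> g y) = \<rho> g (v y)"
    and nz: "\<And>y. y \<in> sphere 0 1 \<Longrightarrow> v y \<noteq> 0"
  shows "has_equivariant_planner_cover G (top_of_set (sphere 0 1)) \<phi> 2"
  unfolding has_equivariant_planner_cover_2
proof (intro exI conjI)
  show "planner_domain G (top_of_set (sphere 0 1)) \<phi> {z \<in> sphere 0 1 \<times> sphere 0 1. fst z \<noteq> - snd z}"
    by (rule planner_domain_nonantipodal)
  show "planner_domain G (top_of_set (sphere 0 1)) \<phi>
    {z \<in> sphere 0 1 \<times> sphere 0 1. fst z \<noteq> snd z \<and> v (snd z) \<noteq> 0}"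
    by (rule planner_domain_tangent_field[OF assms(1-3)])
  have "v (snd z) \<noteq> 0" if "z \<in> sphere 0 1 \<times> sphere 0 1" for z
    using that nz by (simp add: mem_Times_iff)
  \<comment> \<open>Outside the first set x = -y, and a unit vector differs from its negative, so
    the second set contains the pair.\<close>
  moreover have "fst z \<noteq> snd z" if "z \<in> sphere 0 1 \<times> sphere 0 1" "fst z = - snd z" for z :: "'v \<times> 'v"
    using that unit_vector_neq_uminus[of "snd z"] by (simp add: mem_Times_iff)
  ultimately show "{z \<in> sphere 0 1 \<times> sphere 0 1. fst z \<noteq> - snd z} \<union>
     {z \<in> sphere 0 1 \<times> sphere 0 1. fst z \<noteq> snd z \<and> v (snd z) \<noteq> 0}
      = topspace (prod_topology (top_of_set (sphere 0 1)) (top_of_set (sphere 0 1)))"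
    unfolding prod_topology_subtopology_eu topspace_euclidean_subtopology by blast
qed

lemma has_planner_cover_3:
  assumes e: "norm e = 1" "\<And>g. g \<in> carrier G \<Longrightarrow> \<rho> g e = e"
    and e': "norm e' = 1" "\<And>g. g \<in> carrier G \<Longrightarrow> \<rho> g e' = e'" and perp: "e \<bullet> e' = 0"
  shows "has_equivariant_planner_cover G (top_of_set (sphere 0 1)) \<phi> 3"
proof (rule has_equivariant_planner_cover_3I)
  \<comment> \<open>For a unit vector y this is the orthogonal projection of \<open>e\<close> to the
    tangent space at y.\<close>
  define v where "v y = e - (e \<bullet> y) *\<^sub>R y" for y
  show "planner_domain G (top_of_set (sphere 0 1)) \<phi> {z \<in> sphere 0 1 \<times> sphere 0 1. fst z \<noteq> - snd z}"
    by (rule planner_domain_nonantipodal)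
  show "planner_domain G (top_of_set (sphere 0 1)) \<phi>
    {z \<in> sphere 0 1 \<times> sphere 0 1. fst z \<noteq> snd z \<and> v (snd z) \<noteq> 0}"
  proof (rule planner_domain_tangent_field)
    show "continuous_on (sphere 0 1) v" unfolding v_def by (intro continuous_intros)
    show "y \<bullet> v y = 0" if "y \<in> sphere 0 1" for y
      using that by (simp add: v_def inner_diff_right dot_square_norm inner_commute)
    fix g y assume g: "g \<in> carrier G"
    have "e \<bullet> \<rho> g y = e \<bullet> y" using inner_action[OF g, of e y] e(2)[OF g] by simp
    then show "v (\<rho> g y) = \<rho> g (v y)"
      by (simp add: v_def linear_diff[OF lin[OF g]] linear_scale[OF lin[OF g]] e(2)[OF g])
  qed
  show "planner_domain G (top_of_set (sphere 0 1)) \<phi> {z \<in> sphere 0 1 \<times> sphere 0 1. fst z \<noteq> - e' \<and> snd z \<noteq> - e'}"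
    by (rule planner_domain_fixed[OF e'])
  \<comment> \<open>A zero of \<open>v\<close> satisfies e = (e \<bullet> y) y, so e \<bullet> y is
    not 0, whereas \<open>e\<close> is orthogonal to \<open>e'\<close>. Hence the third set takes in
    the pairs (-y, y) that the second one misses.\<close>
  have "y \<noteq> - e' \<and> - y \<noteq> - e'" if y: "norm y = 1" "v y = 0" for y
  proof -
    have "e \<bullet> e = (e \<bullet> y) * (y \<bullet> e)"
      using y(2) unfolding v_def by (metis eq_iff_diff_eq_0 inner_scaleR_left)
    then have "e \<bullet> y \<noteq> 0" using e(1) by (auto simp: dot_square_norm)
    then show ?thesis using perp by (auto simp: inner_minus_right)
  qed
  then have "fst z \<noteq> - e' \<and> snd z \<noteq> - e'"
    if "z \<in> sphere 0 1 \<times> sphere 0 1" "fst z = - snd z" "v (snd z) = 0" for z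
    using that by (simp add: mem_Times_iff)
  moreover have "fst z \<noteq> snd z" if "z \<in> sphere 0 1 \<times> sphere 0 1" "fst z = - snd z" for z :: "'v \<times> 'v"
    using that unit_vector_neq_uminus[of "snd z"] by (simp add: mem_Times_iff)
  ultimately show "{z \<in> sphere 0 1 \<times> sphere 0 1. fst z \<noteq> - snd z} \<union>
     {z \<in> sphere 0 1 \<times> sphere 0 1. fst z \<noteq> snd z \<and> v (snd z) \<noteq> 0} \<union>
     {z \<in> sphere 0 1 \<times> sphere 0 1. fst z \<noteq> - e' \<and> snd z \<noteq> - e'}
      = topspace (prod_topology (top_of_set (sphere 0 1)) (top_of_set (sphere 0 1)))"
    unfolding prod_topology_subtopology_eu topspace_euclidean_subtopology by blast
qed

end

section \<open>Linear actions of cyclic groups\<close>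

text \<open>In an orthonormal basis of \<open>W\<close> the map makes a quarter turn in each plane
  spanned by the vectors with indices 2i and 2i + 1, and it is 0 on the orthogonal
  complement.\<close>

lemma skew_map_exists:
  fixes W :: "'v::euclidean_space set"
  assumes W: "subspace W" "even (dim W)"
  obtains J :: "'v \<Rightarrow> 'v" where "linear J" "\<And>x. x \<bullet> J x = 0" "\<And>x. J x \<in> W"
    "\<And>x. (\<And>w. w \<in> W \<Longrightarrow> w \<bullet> x = 0) \<Longrightarrow> J x = 0" "\<And>x. \<lbrakk>x \<in> W; J x = 0\<rbrakk> \<Longrightarrow> x = 0"
proof -
  obtain l where l: "dim W = 2 * l" using W(2) by (elim evenE)
  obtain B where B: "B \<subseteq> W" "pairwise orthogonal B" "\<And>x. x \<in> B \<Longrightarrow> norm x = 1"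
      "independent B" "card B = dim W" "span B = W"
    using orthonormal_basis_subspace[OF W(1)] by metis
  have "finite B" using B(4) finiteI_independent by blast
  then obtain b where "bij_betw b {0..<card B} B" using ex_bij_betw_nat_finite by blast
  then have b: "bij_betw b {..<2 * l} B" using B(5) l by (simp add: atLeast0LessThan)
  have bB: "b i \<in> B" if "i < 2 * l" for i using b that by (auto simp: bij_betw_def)
  have on: "b i \<bullet> b j = (if i = j then 1 else 0)" if "i < 2 * l" "j < 2 * l" for i j
  proof (cases "i = j")
    case True
    then show ?thesis using B(3)[OF bB[OF that(1)]] by (simp add: dot_square_norm)
  next
    case False
    then have "b i \<noteq> b j" using b that by (auto simp: bij_betw_def inj_on_def)
    then have "orthogonal (b i) (b j)" using B(2) bB that unfolding pairwise_def by blast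
    then show ?thesis using False by (simp add: orthogonal_def)
  qed
  define J where "J x = (\<Sum>i<l. (x \<bullet> b (2 * i)) *\<^sub>R b (2 * i + 1) - (x \<bullet> b (2 * i + 1)) *\<^sub>R b (2 * i))" for x
  show thesis
  proof
    show "linear J"
      by (rule linearI) (simp_all add: J_def inner_add_left algebra_simps sum.distrib sum_subtractf scaleR_sum_right)
    show "x \<bullet> J x = 0" for x
      by (simp add: J_def inner_sum_right inner_diff_right)
    show "J x \<in> W" for x
    proof -
      have "b i \<in> W" if "i < 2 * l" for i using bB[OF that] B(1) by blast
      then show ?thesis
        unfolding J_def by (intro subspace_sum subspace_diff subspace_scale W(1)) auto
    qed
    show "J x = 0" if "\<And>w. w \<in> W \<Longrightarrow> w \<bullet> x = 0" for x
    proof -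
      have "x \<bullet> b i = 0" if "i < 2 * l" for i
        using bB[OF that] B(1) \<open>\<And>w. w \<in> W \<Longrightarrow> w \<bullet> x = 0\<close> by (metis inner_commute subsetD)
      then show ?thesis unfolding J_def by (intro sum.neutral) auto
    qed
    fix x assume x: "x \<in> W" "J x = 0"
    \<comment> \<open>Up to sign, the coefficients of \<open>J x\<close> are those of x, exchanged
      within each pair.\<close>
    have "x \<bullet> b (2 * j) = 0 \<and> x \<bullet> b (2 * j + 1) = 0" if j: "j < l" for j
    proof -
      have "J x \<bullet> b (2 * j + 1) = (\<Sum>i<l. if i = j then x \<bullet> b (2 * j) else 0)"
        unfolding J_def inner_sum_left inner_diff_left using on j by (intro sum.cong) auto
      moreover have "J x \<bullet> b (2 * j) = (\<Sum>i<l. if i = j then - (x \<bullet> b (2 * j + 1)) else 0)"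
        unfolding J_def inner_sum_left inner_diff_left using on j by (intro sum.cong) auto
      ultimately show ?thesis using x(2) j by simp
    qed
    then have "x \<bullet> b i = 0" if "i < 2 * l" for i
      using that by (cases "even i") (auto elim!: evenE oddE)
    then have "orthogonal x y" if "y \<in> B" for y
      using b that by (auto simp: bij_betw_def orthogonal_def)
    then have "orthogonal x x" using orthogonal_to_span x(1) B(6) by blast
    then show "x = 0" by (simp add: orthogonal_self)
  qed
qed

section \<open>Fixed subspaces of cyclic actions and equivariant tangent fields\<close>

locale linear_cyclic_sphere = linear_sphere "integer_mod_group p" \<rho>
  for p :: nat and \<rho> :: "int \<Rightarrow> 'v::euclidean_space \<Rightarrow> 'v" +
  assumes p: "prime p"
begin

abbreviation "G \<equiv> integer_mod_group p"

definition fixed_subspace :: "'v set" where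
  "fixed_subspace = {x. \<forall>g\<in>carrier G. \<rho> g x = x}"

lemma carrier_iff: "g \<in> carrier G \<longleftrightarrow> 0 \<le> g \<and> g < int p"
  using prime_gt_0_nat[OF p] by (auto simp: carrier_integer_mod_group)

lemma action_add:
  assumes "g \<in> carrier G" "h \<in> carrier G"
  shows "\<rho> ((g + h) mod int p) x = \<rho> g (\<rho> h x)"
proof -
  interpret group_action G UNIV \<rho>
    using rep by (simp add: orthogonal_representation_def)
  show ?thesis using composition_rule[of x g h] assms by simp
qed

lemma action_commute: "\<lbrakk>g \<in> carrier G; h \<in> carrier G\<rbrakk> \<Longrightarrow> \<rho> g (\<rho> h x) = \<rho> h (\<rho> g x)"
  using action_add[of g h x] action_add[of h g x] by (simp add: add.commute)

lemma action_0 [simp]: "\<rho> 0 x = x"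
proof -
  have 0: "0 \<in> carrier G" using prime_gt_0_nat[OF p] by (simp add: carrier_iff)
  have "\<rho> 0 (\<rho> 0 x) = \<rho> 0 x" using action_add[OF 0 0] by simp
  then show ?thesis using inj_action[OF 0] by simp
qed

lemma one_carrier: "1 \<in> carrier G"
  using prime_gt_1_nat[OF p] by (simp add: carrier_iff)

lemma action_Suc: "int (Suc j) < int p \<Longrightarrow> \<rho> (int (Suc j)) x = \<rho> 1 (\<rho> (int j) x)"
  using action_add[OF one_carrier, of "int j" x] by (simp add: carrier_iff)

text \<open>The residue \<open>int p - 1\<close> is the inverse of the generator 1.\<close>

lemma action_inverse: "\<rho> 1 (\<rho> (int p - 1) x) = x" "\<rho> (int p - 1) (\<rho> 1 x) = x"
  and minus_one_carrier: "int p - 1 \<in> carrier G"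
proof -
  show c: "int p - 1 \<in> carrier G" using prime_gt_1_nat[OF p] by (simp add: carrier_iff)
  show "\<rho> 1 (\<rho> (int p - 1) x) = x" using action_add[OF one_carrier c, of x] by simp
  then show "\<rho> (int p - 1) (\<rho> 1 x) = x" using action_commute[OF one_carrier c] by simp
qed

text \<open>The element 1 generates the group, so j acts as the j-th iterate of its action.\<close>

lemma fixed_subspaceI:
  assumes "\<rho> 1 x = x"
  shows "x \<in> fixed_subspace"
proof -
  have "\<rho> (int j) x = x" if "int j < int p" for j
    using that
  proof (induction j)
    case (Suc j)
    then have "\<rho> (int (Suc j)) x = \<rho> 1 (\<rho> (int j) x)" by (intro action_Suc)
    then show ?case using Suc assms by simp
  qed simp
  then have "\<rho> g x = x" if "g \<in> carrier G" for g
    using that unfolding carrier_iff by (metis nonneg_int_cases)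
  then show ?thesis by (simp add: fixed_subspace_def)
qed

text \<open>Since \<open>p\<close> is odd, the square of the generator generates the group as well.\<close>

lemma fixed_subspaceI_square:
  assumes "odd p" "\<rho> 1 (\<rho> 1 x) = x"
  shows "x \<in> fixed_subspace"
proof -
  have "\<rho> (int (2 * j)) x = x" if "2 * j < p" for j
    using that
  proof (induction j)
    case (Suc j)
    have "\<rho> (int (2 * Suc j)) x = \<rho> 1 (\<rho> (int (2 * j + 1)) x)"
      using action_Suc[of "2 * j + 1" x] Suc.prems by simp
    also have "\<dots> = \<rho> 1 (\<rho> 1 (\<rho> (int (2 * j)) x))"
      using action_Suc[of "2 * j" x] Suc.prems by simp
    also have "\<dots> = x" using Suc assms(2) by simp
    finally show ?case .
  qed simp
  moreover obtain r where "p = 2 * r + 1" using assms(1) by (elim oddE)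
  ultimately have "\<rho> (int p - 1) x = x" by force
  then show ?thesis using action_inverse(1)[of x] by (intro fixed_subspaceI) simp
qed

lemma subspace_fixed: "subspace fixed_subspace"
  using linear_0[OF lin] linear_add[OF lin] linear_scale[OF lin]
  by (auto simp: subspace_def fixed_subspace_def)

lemma fixed_point_set_eq:
  "fixed_point_set G (sphere 0 1) \<phi> = sphere 0 1 \<inter> fixed_subspace"
  by (auto simp: fixed_point_set_def fixed_subspace_def sphere_action_def)

text \<open>A subspace is recovered from its unit sphere by scaling, so the fixed subspace is the
  very subspace that cuts out the standard subsphere.\<close>

lemma dim_fixed_subspace:
  assumes "standard_subsphere k (fixed_point_set G (sphere 0 1) \<phi>)"
  shows "dim fixed_subspace = k + 1"
proof -
  obtain V where V: "subspace V" "dim V = k + 1" "sphere 0 1 \<inter> fixed_subspace = sphere 0 1 \<inter> V"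
    using assms unfolding standard_subsphere_def fixed_point_set_eq by auto
  have "x \<in> B" if A: "subspace A" and B: "subspace B" and AB: "sphere 0 1 \<inter> A \<subseteq> B" and x: "x \<in> A"
    for A B :: "'v set" and x
  proof (cases "x = 0")
    case True
    then show ?thesis using B subspace_0 by blast
  next
    case False
    then have "x /\<^sub>R norm x \<in> sphere 0 1 \<inter> A" using normalize_in_sphere[OF A, of x] x by simp
    then have "x /\<^sub>R norm x \<in> B" using AB by blast
    then have "norm x *\<^sub>R (x /\<^sub>R norm x) \<in> B" by (rule subspace_scale[OF B])
    then show ?thesis using False by simp
  qed
  then have "fixed_subspace = V" using V subspace_fixed by (metis Int_lower2 subsetI subset_antisym)
  then show ?thesis using V(2) by simp
qed

text \<open>Two distinct members of an orthonormal basis of the fixed subspace serve as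
  \<open>e\<close> and \<open>e'\<close>.\<close>

lemma has_planner_cover_3_cyclic:
  assumes "dim fixed_subspace \<ge> 2"
  shows "has_equivariant_planner_cover G (top_of_set (sphere 0 1)) \<phi> 3"
proof -
  obtain B where B: "B \<subseteq> fixed_subspace" "pairwise orthogonal B" "\<And>x. x \<in> B \<Longrightarrow> norm x = 1"
      "card B = dim fixed_subspace"
    using orthonormal_basis_subspace[OF subspace_fixed] by metis
  obtain e e' where "e \<in> B" "e' \<in> B" "e \<noteq> e'"
    using assms B(4) by (metis card_le_Suc0_iff_eq card_eq_0_iff not_less_eq_eq numeral_2_eq_2 not_numeral_le_zero)
  then show ?thesis
    using B by (intro has_planner_cover_3[of e e'])
      (auto simp: fixed_subspace_def pairwise_def orthogonal_def)
qed

text \<open>On the orthogonal complement of the fixed subspace a skew equivariant injection is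
  \<open>T - T\<^sup>-\<^sup>1\<close> for odd \<open>p\<close>, where \<open>T\<close> is the generator; for \<open>p = 2\<close> the generator acts there as
  \<open>-1\<close>, so any skew injection will do.\<close>

lemma normal_skew_map_exists:
  assumes even: "even (DIM('v) - dim fixed_subspace)"
  obtains L :: "'v \<Rightarrow> 'v" where "linear L" "\<And>x. x \<bullet> L x = 0"
    "\<And>w x. w \<in> fixed_subspace \<Longrightarrow> w \<bullet> L x = 0" "\<And>x. L x = 0 \<Longrightarrow> x \<in> fixed_subspace"
    "\<And>g x. g \<in> carrier G \<Longrightarrow> L (\<rho> g x) = \<rho> g (L x)"
proof (cases "odd p")
  case True
  define L where "L x = \<rho> 1 x - \<rho> (int p - 1) x" for x
  note c1 = one_carrier and c2 = minus_one_carrier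
  show thesis
  proof
    show "linear L"
      unfolding L_def by (intro linear_compose_sub lin c1 c2)
    \<comment> \<open>By orthogonality the adjoint of the inverse generator is the generator. This
      makes \<open>L\<close> skew and its values orthogonal to fixed vectors.\<close>
    have T: "x \<bullet> \<rho> (int p - 1) y = \<rho> 1 x \<bullet> y" for x y
      using inner_action[OF c1, of x "\<rho> (int p - 1) y"] action_inverse(1) by simp
    show "x \<bullet> L x = 0" for x
      by (simp add: L_def inner_diff_right T inner_commute)
    show "w \<bullet> L x = 0" if "w \<in> fixed_subspace" for w x
    proof -
      have "\<rho> 1 w = w" using that c1 by (simp add: fixed_subspace_def)
      then show ?thesis using T[of w x] inner_action[OF c1, of w x] by (simp add: L_def inner_diff_right)
    qed
    show "x \<in> fixed_subspace" if "L x = 0" for x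
    proof -
      have "\<rho> 1 (\<rho> 1 x) = \<rho> 1 (\<rho> (int p - 1) x)" using that by (simp add: L_def)
      then show ?thesis using True action_inverse(1) by (intro fixed_subspaceI_square) simp_all
    qed
    show "L (\<rho> g x) = \<rho> g (L x)" if "g \<in> carrier G" for g x
      by (simp add: L_def linear_diff[OF lin[OF that]] action_commute[OF that c1] action_commute[OF that c2])
  qed
next
  case False
  then have p2: "p = 2" using p primes_dvd_imp_eq two_is_prime_nat by blast
  define N where "N = {y. \<forall>x\<in>fixed_subspace. orthogonal x y}"
  have N: "subspace N"
    by (auto simp: N_def subspace_def orthogonal_def inner_add_right)
  have "dim N + dim fixed_subspace = DIM('v)"
    using dim_subspace_orthogonal_to_vectors[OF subspace_fixed subspace_UNIV] by (simp add: N_def)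
  then have "even (dim N)" using even by (metis add_diff_cancel_right')
  then obtain L :: "'v \<Rightarrow> 'v" where L: "linear L" "\<And>x. x \<bullet> L x = 0" "\<And>x. L x \<in> N"
    "\<And>x. (\<And>w. w \<in> N \<Longrightarrow> w \<bullet> x = 0) \<Longrightarrow> L x = 0" "\<And>x. \<lbrakk>x \<in> N; L x = 0\<rbrakk> \<Longrightarrow> x = 0"
    using skew_map_exists[OF N] by metis
  have W0: "L w = 0" if "w \<in> fixed_subspace" for w
    using that by (intro L(4)) (auto simp: N_def orthogonal_def inner_commute)
  have TT: "\<rho> 1 (\<rho> 1 x) = x" for x using action_inverse(1)[of x] p2 by simp
  \<comment> \<open>The sum \<open>u + \<rho> 1 u\<close> is fixed because the generator is an
    involution, and it also lies in \<open>N\<close>. Being orthogonal to itself, it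
    vanishes.\<close>
  have TN: "\<rho> 1 u = - u" if u: "u \<in> N" for u
  proof -
    have f: "u + \<rho> 1 u \<in> fixed_subspace"
      using TT by (intro fixed_subspaceI) (simp add: linear_add[OF lin[OF one_carrier]] add.commute)
    have "\<rho> 1 u \<in> N"
      unfolding N_def
    proof (intro CollectI ballI)
      fix w assume w: "w \<in> fixed_subspace"
      then have "\<rho> 1 w = w" using one_carrier by (simp add: fixed_subspace_def)
      then show "orthogonal w (\<rho> 1 u)"
        using inner_action[OF one_carrier, of w u] u w by (simp add: N_def orthogonal_def)
    qed
    then have "u + \<rho> 1 u \<in> N" using u N subspace_add by blast
    then have "orthogonal (u + \<rho> 1 u) (u + \<rho> 1 u)" using f by (auto simp: N_def)
    then show ?thesis by (simp add: orthogonal_self eq_neg_iff_add_eq_0 add.commute)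
  qed
  have decomp: "\<exists>w u. w \<in> fixed_subspace \<and> u \<in> N \<and> x = w + u" for x
  proof -
    obtain w u where "w \<in> span fixed_subspace" "\<And>y. y \<in> span fixed_subspace \<Longrightarrow> orthogonal u y" "x = w + u"
      using orthogonal_subspace_decomp_exists by metis
    then show ?thesis
      using subspace_fixed by (auto simp: N_def span_eq_iff[THEN iffD2] orthogonal_commute)
  qed
  show thesis
  proof
    show "linear L" by (rule L(1))
    show "x \<bullet> L x = 0" for x by (rule L(2))
    show "w \<bullet> L x = 0" if "w \<in> fixed_subspace" for w x
      using L(3)[of x] that by (auto simp: N_def orthogonal_def)
    show "x \<in> fixed_subspace" if "L x = 0" for x
    proof -
      obtain w u where wu: "w \<in> fixed_subspace" "u \<in> N" "x = w + u" using decomp by blast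
      then have "L u = 0" using that W0 linear_add[OF L(1)] by simp
      then have "u = 0" by (rule L(5)[OF wu(2)])
      then show ?thesis using wu by simp
    qed
    fix g x assume "g \<in> carrier G"
    then have "g = 0 \<or> g = 1" using p2 unfolding carrier_iff by auto
    moreover have "L (\<rho> 1 x) = \<rho> 1 (L x)"
    proof -
      obtain w u where wu: "w \<in> fixed_subspace" "u \<in> N" "x = w + u" using decomp by blast
      have w: "\<rho> 1 w = w" using wu(1) one_carrier by (simp add: fixed_subspace_def)
      have "L (\<rho> 1 x) = L w + L (- u)"
        by (simp add: wu(3) linear_add[OF lin[OF one_carrier]] w TN[OF wu(2)] linear_diff[OF L(1)] linear_neg[OF L(1)])
      also have "\<dots> = - L x"
        using W0[OF wu(1)] by (simp add: wu(3) linear_add[OF L(1)] linear_neg[OF L(1)])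
      also have "\<dots> = \<rho> 1 (L x)" using TN[OF L(3)] by simp
      finally show ?thesis .
    qed
    ultimately show "L (\<rho> g x) = \<rho> g (L x)" by auto
  qed
qed

text \<open>The field is the sum of a skew map \<open>J\<close>, injective on the fixed subspace and
  with values there, and of a skew equivariant map \<open>L\<close> with values in the orthogonal
  complement and kernel inside the fixed subspace.\<close>

lemma has_planner_cover_2_cyclic:
  assumes "even (dim fixed_subspace)" "even (DIM('v) - dim fixed_subspace)"
  shows "has_equivariant_planner_cover G (top_of_set (sphere 0 1)) \<phi> 2"
proof -
  obtain J :: "'v \<Rightarrow> 'v" where J: "linear J" "\<And>x. x \<bullet> J x = 0" "\<And>x. J x \<in> fixed_subspace"
    "\<And>x. (\<And>w. w \<in> fixed_subspace \<Longrightarrow> w \<bullet> x = 0) \<Longrightarrow> J x = 0"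
    "\<And>x. \<lbrakk>x \<in> fixed_subspace; J x = 0\<rbrakk> \<Longrightarrow> x = 0"
    using skew_map_exists[OF subspace_fixed assms(1)] by metis
  obtain L :: "'v \<Rightarrow> 'v" where L: "linear L" "\<And>x. x \<bullet> L x = 0"
    "\<And>w x. w \<in> fixed_subspace \<Longrightarrow> w \<bullet> L x = 0" "\<And>x. L x = 0 \<Longrightarrow> x \<in> fixed_subspace"
    "\<And>g x. g \<in> carrier G \<Longrightarrow> L (\<rho> g x) = \<rho> g (L x)"
    using normal_skew_map_exists[OF assms(2)] by metis
  show ?thesis
  proof (rule has_planner_cover_2[where v = "\<lambda>y. J y + L y"])
    show "continuous_on (sphere 0 1) (\<lambda>y. J y + L y)"
      by (intro continuous_intros linear_continuous_on linear_linear[THEN iffD2] J(1) L(1))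
    show "y \<bullet> (J y + L y) = 0" for y by (simp add: inner_add_right J(2) L(2))
    fix g y assume g: "g \<in> carrier G"
    \<comment> \<open>The difference \<open>\<rho> g y - y\<close> is orthogonal to all fixed
      vectors, so \<open>J\<close> kills it. As the values of \<open>J\<close> are fixed,
      \<open>J\<close> is equivariant.\<close>
    have "w \<bullet> (\<rho> g y - y) = 0" if "w \<in> fixed_subspace" for w
    proof -
      have "\<rho> g w = w" using that g by (simp add: fixed_subspace_def)
      then show ?thesis using inner_action[OF g, of w y] by (simp add: inner_diff_right)
    qed
    then have "J (\<rho> g y - y) = 0" by (rule J(4))
    then have "J (\<rho> g y) = J y" by (simp add: linear_diff[OF J(1)])
    moreover have "\<rho> g (J y) = J y" using J(3) g by (auto simp: fixed_subspace_def)
    ultimately show "J (\<rho> g y) + L (\<rho> g y) = \<rho> g (J y + L y)"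
      by (simp add: linear_add[OF lin[OF g]] L(5)[OF g])
  next
    fix y :: 'v assume y: "y \<in> sphere 0 1"
    show "J y + L y \<noteq> 0"
    proof
      assume 0: "J y + L y = 0"
      \<comment> \<open>\<open>J y\<close> is fixed and hence orthogonal to \<open>L y\<close>, so
        both vanish. Then y lies in the fixed subspace, where \<open>J\<close> is injective.\<close>
      have "J y \<bullet> (J y + L y) = J y \<bullet> J y" by (simp add: inner_add_right L(3)[OF J(3)])
      then have "J y = 0" using 0 by simp
      then have "y = 0" using 0 L(4) J(5) by simp
      then show False using y by simp
    qed
  qed
qed

end

theorem theorem3p5:
  fixes p n k :: nat
    and \<rho> :: "int \<Rightarrow> real ^ 'd \<Rightarrow> real ^ 'd"
  assumes "prime p"
    and "CARD('d) = n + 1"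
    and "orthogonal_representation (integer_mod_group p) \<rho>"
    and "standard_subsphere k
           (fixed_point_set (integer_mod_group p) (sphere 0 1) (sphere_action \<rho>))"
    and "0 < k" and "k < n"
  shows "(odd n \<and> odd k \<longrightarrow>
           equivariant_TC (integer_mod_group p) (top_of_set (sphere 0 1)) (sphere_action \<rho>) = 2) \<and>
         (even n \<or> even k \<longrightarrow>
           equivariant_TC (integer_mod_group p) (top_of_set (sphere 0 1)) (sphere_action \<rho>) = 3)"
proof -
  interpret linear_cyclic_sphere p \<rho>
    using assms(1,3) by unfold_locales
  let ?has = "has_equivariant_planner_cover G (top_of_set (sphere 0 1)) \<phi>"
  have dim: "dim fixed_subspace = k + 1" using dim_fixed_subspace[OF assms(4)] .
  have not1: "\<not> ?has 1" by (rule no_equivariant_planner_cover_1)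
  show ?thesis
  proof (intro conjI impI)
    assume "odd n \<and> odd k"
    \<comment> \<open>The fixed subspace has dimension k + 1 and its complement dimension n - k;
      both are even when n and k are odd.\<close>
    then have "?has 2"
      using assms(2,6) by (intro has_planner_cover_2_cyclic) (auto simp: dim)
    then have "equivariant_TC G (top_of_set (sphere 0 1)) \<phi> = enat 2"
      using not1 by (intro equivariant_TC_eqI) (auto simp: less_2_cases_iff)
    then show "equivariant_TC G (top_of_set (sphere 0 1)) \<phi> = 2" by (simp add: numeral_eq_enat)
  next
    assume "even n \<or> even k"
    then have not2: "\<not> ?has 2"
    proof
      \<comment> \<open>The obstruction comes from the whole sphere.\<close>
      assume "even n"
      then show ?thesis
        using assms(2,5,6)
        by (intro no_equivariant_planner_cover_2[where W = UNIV and m = n]) auto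
    next
      \<comment> \<open>The obstruction comes from the fixed sphere, of even dimension k.\<close>
      assume "even k"
      then show ?thesis
        using dim assms(5)
        by (intro no_equivariant_planner_cover_2[OF subspace_fixed]) (auto simp: fixed_point_set_eq)
    qed
    have "?has 3" using dim assms(5) by (intro has_planner_cover_3_cyclic) simp
    moreover have "\<not> ?has j" if "1 \<le> j" "j < 3" for j
    proof -
      have "j = 1 \<or> j = 2" using that by linarith
      then show ?thesis using not1 not2 by auto
    qed
    ultimately have "equivariant_TC G (top_of_set (sphere 0 1)) \<phi> = enat 3"
      by (intro equivariant_TC_eqI) auto
    then show "equivariant_TC G (top_of_set (sphere 0 1)) \<phi> = 3" by (simp add: numeral_eq_enat)
  qed
qed

end
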